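(* Let $\lambda$ be a composition of $n$ with $r$ parts. Regard $S_n=\langle s_1,\ldots,s_{n-1}\rangle$ as a standard parabolic subgroup of $S_{n+1}=\langle s_1,\ldots,s_n\rangle$, where $s_i=(i,i+1)$, and let $\hat{\mathfrak X}$ be the set of distinguished (minimum length) right coset representatives of $S_n$ in $S_{n+1}$. For $D\in\mathcal E^{(\lambda)}$ define $\hat D=\{(r+1,1)\}\cup\{(i,j+1)\colon (i,j)\in D\}$, a diagram of size $n+1$. Then the minimal determining set of the right ideal $Z(\lambda)\hat{\mathfrak X}$ in $S_{n+1}$ is the set $\{w_{\hat D}\colon D\in\mathcal E^{(\lambda)}\}$.
   Context: $S_n$ acts on the right on $\{1,\ldots,n\}$ (in a product $xy$, $x$ is applied first), with Coxeter generators $S=\{s_1,\ldots,s_{n-1}\}$; similarly for $S_{n+1}$. $x$ is a prefix of $y$ if $y$ has a reduced form beginning with a reduced form for $x$. A right ideal is a subset closed under taking prefixes; its minimal determining set is the set of its elements that are not prefixes of any other of its elements. For $J\subseteq S$, $W_J=\langle J\rangle$, $w_J$ is the longest element of $W_J$, and $\mathfrak X_J$ is the set of minimum length elements in the right cosets $W_Jx$ of $W_J$ in $S_n$. The relation $\sim_R$ is the Kazhdan–Lusztig equivalence whose classes are the right cells (in the convention in which the right cell containing $w_J$ is contained in $w_J\mathfrak X_J$, i.e. elements of one right cell have the same left descent set). Compositions have no zero parts. For a composition $\lambda=(\lambda_1,\ldots,\lambda_r)$ of $n$, $J(\lambda)=S\setminus\{s_{\lambda_1},s_{\lambda_1+\lambda_2},\ldots,s_{\lambda_1+\cdots+\lambda_{r-1}}\}$.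 A diagram $D$ is a non-empty finite subset of $\mathbb Z^2$ with rows and columns indexed consecutively from 1 and none empty; the node $(a,b)$ is in row $a$ (top to bottom) and column $b$ (left to right). $\mathcal D^{(\lambda)}$ is the set of diagrams whose $k$-th row has exactly $\lambda_k$ nodes for each $k$ (and which have exactly $r$ rows). For a diagram $D$ of size $m$, $t^D$ and $t_D$ are the bijections $D\to\{1,\ldots,m\}$ obtained by filling the nodes with $1,\ldots,m$ in order by rows and by columns, respectively (rows top to bottom, each left to right; columns left to right, each top to bottom), and $w_D\in S_m$ is defined by $t^Dw_D=t_D$, where $tw$ is obtained from $t$ by replacing each entry $i$ by $iw$. For $d\in\mathfrak X_{J(\lambda)}$, $D(d,\lambda)$ is the unique diagram with the minimum number of columns among all $E\in\mathcal D^{(\lambda)}$ with $w_E=d$. $Z(\lambda)=\{e\in\mathfrak X_{J(\lambda)}\colon w_{J(\lambda)}e\sim_Rw_{J(\lambda)}\}$, which is a right ideal in $S_n$; $Y(\lambda)$ is the minimal determining set of $Z(\lambda)$; $\mathcal E^{(\lambda)}=\{D(y,\lambda)\colon y\in Y(\lambda)\}$. *)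

theory Defs
  imports "HOL-Combinatorics.Permutations" "HOL-Computational_Algebra.Polynomial"
begin

section \<open>The symmetric group as a Coxeter group\<close>

text \<open>
  The group \<open>S_n\<close> consists of the maps \<open>nat \<Rightarrow> nat\<close> permuting \<open>{1..n}\<close>, so that \<open>S_n\<close> is literally
  a subset of \<open>S_(n+1)\<close>. Permutations act on the right: in \<open>x \<odot> y\<close>, \<open>x\<close> is applied first.
  Subsets \<open>J\<close> of the generating set are represented by the sets of indices \<open>i\<close> of the
  generators \<open>s_i\<close>, and words by lists of such indices.
\<close>

definition Sym :: "nat \<Rightarrow> (nat \<Rightarrow> nat) set"
  where "Sym n = {w. w permutes {1..n}}"

definition rprod :: "(nat \<Rightarrow> nat) \<Rightarrow> (nat \<Rightarrow> nat) \<Rightarrow> nat \<Rightarrow> nat"  (infixl "\<odot>" 70)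
  where "x \<odot> y = y \<circ> x"

definition gen :: "nat \<Rightarrow> nat \<Rightarrow> nat"
  where "gen i = Transposition.transpose i (Suc i)"

definition word_prod :: "nat list \<Rightarrow> nat \<Rightarrow> nat"
  where "word_prod us = foldr (\<lambda>i w. gen i \<odot> w) us id"

definition len :: "nat \<Rightarrow> (nat \<Rightarrow> nat) \<Rightarrow> nat"
  where "len n w = (LEAST k. \<exists>us. set us \<subseteq> {1..<n} \<and> word_prod us = w \<and> length us = k)"

definition reduced_form :: "nat \<Rightarrow> nat list \<Rightarrow> (nat \<Rightarrow> nat) \<Rightarrow> bool"
  where "reduced_form n us w \<longleftrightarrow> set us \<subseteq> {1..<n} \<and> word_prod us = w \<and> length us = len n w"

definition is_prefix :: "nat \<Rightarrow> (nat \<Rightarrow> nat) \<Rightarrow> (nat \<Rightarrow> nat) \<Rightarrow> bool"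
  where "is_prefix n x y \<longleftrightarrow> (\<exists>us vs. reduced_form n us x \<and> reduced_form n (us @ vs) y)"

definition right_ideal :: "nat \<Rightarrow> (nat \<Rightarrow> nat) set \<Rightarrow> bool"
  where "right_ideal n A \<longleftrightarrow> A \<subseteq> Sym n \<and> (\<forall>y\<in>A. \<forall>x\<in>Sym n. is_prefix n x y \<longrightarrow> x \<in> A)"

definition min_det_set :: "nat \<Rightarrow> (nat \<Rightarrow> nat) set \<Rightarrow> (nat \<Rightarrow> nat) set"
  where "min_det_set n A = {y \<in> A. \<not> (\<exists>z\<in>A. z \<noteq> y \<and> is_prefix n y z)}"

definition set_prod :: "(nat \<Rightarrow> nat) set \<Rightarrow> (nat \<Rightarrow> nat) set \<Rightarrow> (nat \<Rightarrow> nat) set"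
  where "set_prod A B = {x \<odot> y | x y. x \<in> A \<and> y \<in> B}"

text \<open>The generators are involutions, so the subgroup they generate is the set of their words.\<close>

definition parabolic :: "nat set \<Rightarrow> (nat \<Rightarrow> nat) set"
  where "parabolic J = {word_prod us | us. set us \<subseteq> J}"

definition longest :: "nat \<Rightarrow> nat set \<Rightarrow> nat \<Rightarrow> nat"
  where "longest n J = (ARG_MAX (len n) w. w \<in> parabolic J)"

definition min_reps :: "nat \<Rightarrow> nat set \<Rightarrow> (nat \<Rightarrow> nat) set"
  where "min_reps n J = {x \<in> Sym n. \<forall>u\<in>parabolic J. len n x \<le> len n (u \<odot> x)}"

definition right_descents :: "nat \<Rightarrow> (nat \<Rightarrow> nat) \<Rightarrow> nat set"
  where "right_descents n w = {i \<in> {1..<n}. len n (w \<odot> gen i) < len n w}"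

definition bruhat_step :: "nat \<Rightarrow> (nat \<Rightarrow> nat) \<Rightarrow> (nat \<Rightarrow> nat) \<Rightarrow> bool"
  where "bruhat_step n x y \<longleftrightarrow> x \<in> Sym n \<and> len n x < len n y \<and>
    (\<exists>a\<in>{1..n}. \<exists>b\<in>{1..n}. a \<noteq> b \<and> y = x \<odot> Transposition.transpose a b)"

abbreviation bruhat_le :: "nat \<Rightarrow> (nat \<Rightarrow> nat) \<Rightarrow> (nat \<Rightarrow> nat) \<Rightarrow> bool"
  where "bruhat_le n \<equiv> (bruhat_step n)\<^sup>*\<^sup>*"

abbreviation bruhat_less :: "nat \<Rightarrow> (nat \<Rightarrow> nat) \<Rightarrow> (nat \<Rightarrow> nat) \<Rightarrow> bool"
  where "bruhat_less n \<equiv> (bruhat_step n)\<^sup>+\<^sup>+"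

lemma bruhat_less_len: "bruhat_less n x y \<Longrightarrow> len n x < len n y"
  by (induction rule: tranclp_induct) (auto simp: bruhat_step_def)

lemma bruhat_le_len: "bruhat_le n x y \<Longrightarrow> len n x \<le> len n y"
  by (induction rule: rtranclp_induct) (auto simp: bruhat_step_def)

section \<open>Kazhdan--Lusztig polynomials and right cells\<close>

text \<open>
  The polynomials \<open>R_(x,w)\<close> in \<open>q\<close> (the coefficients of \<open>T_(w^-1)^-1\<close> in the Hecke algebra, up to
  normalisation) are given by the standard recursion, for a right descent \<open>s\<close> of \<open>w\<close>:
  \<open>R_(x,w) = R_(xs,ws)\<close> if \<open>s\<close> is a right descent of \<open>x\<close>, and
  \<open>R_(x,w) = q R_(xs,ws) + (q - 1) R_(x,ws)\<close> otherwise, with \<open>R_(x,1) = (if x = 1 then 1 else 0)\<close>.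
  Here the recursion follows a reduced form of \<open>w\<close> written backwards; the result does not depend on it.
\<close>

primrec R_word :: "nat \<Rightarrow> nat list \<Rightarrow> (nat \<Rightarrow> nat) \<Rightarrow> int poly" where
  "R_word n [] x = (if x = id then 1 else 0)"
| "R_word n (i # us) x =
     (if i \<in> right_descents n x then R_word n us (x \<odot> gen i)
      else [:0, 1:] * R_word n us (x \<odot> gen i) + [:-1, 1:] * R_word n us x)"

definition R_poly :: "nat \<Rightarrow> (nat \<Rightarrow> nat) \<Rightarrow> (nat \<Rightarrow> nat) \<Rightarrow> int poly"
  where "R_poly n x w = R_word n (rev (SOME us. reduced_form n us w)) x"

text \<open>\<open>q_bar d p\<close> is \<open>q^d p(1/q)\<close>, for \<open>p\<close> of degree at most \<open>d\<close>.\<close>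

definition q_bar :: "nat \<Rightarrow> int poly \<Rightarrow> int poly"
  where "q_bar d p = (\<Sum>i\<le>d. monom (coeff p i) (d - i))"

text \<open>
  The Kazhdan--Lusztig polynomials are the unique family with \<open>P_(w,w) = 1\<close>, \<open>P_(x,w) = 0\<close> unless
  \<open>x \<le> w\<close>, \<open>deg P_(x,w) \<le> (l(w) - l(x) - 1) / 2\<close> for \<open>x < w\<close>, and
  \<open>q^(l(w) - l(x)) P_(x,w)(1/q) = \<Sum>_(x \<le> y \<le> w) R_(x,y) P_(y,w)\<close>. In the following recursion the
  summand for \<open>y = x\<close>, in which \<open>R_(x,x) = 1\<close>, has been moved to the left-hand side.
\<close>

function KL_poly :: "nat \<Rightarrow> (nat \<Rightarrow> nat) \<Rightarrow> (nat \<Rightarrow> nat) \<Rightarrow> int poly" where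
  "KL_poly n x w =
     (if x = w then 1
      else if bruhat_less n x w then
        (THE p. 2 * degree p + 1 \<le> len n w - len n x \<and>
           q_bar (len n w - len n x) p - p =
           (\<Sum>y\<in>{y. bruhat_less n x y \<and> bruhat_le n y w}. R_poly n x y * KL_poly n y w))
      else 0)"
  by auto
termination
  by (relation "Wellfounded.measure (\<lambda>(n, x, w). len n w - len n x)")
    (auto dest!: bruhat_less_len bruhat_le_len)

declare KL_poly.simps [simp del]

definition KL_mu :: "nat \<Rightarrow> (nat \<Rightarrow> nat) \<Rightarrow> (nat \<Rightarrow> nat) \<Rightarrow> int"
  where "KL_mu n x w =
    (if bruhat_less n x w \<and> odd (len n w - len n x)
     then coeff (KL_poly n x w) ((len n w - len n x - 1) div 2) else 0)"

text \<open>
  With the following convention \<open>xs \<le>\<^sub>R x\<close> whenever \<open>xs > x\<close>, and the elements of a right cell have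
  the same left descent set.
\<close>

definition KL_right_step :: "nat \<Rightarrow> (nat \<Rightarrow> nat) \<Rightarrow> (nat \<Rightarrow> nat) \<Rightarrow> bool"
  where "KL_right_step n x y \<longleftrightarrow> x \<in> Sym n \<and> y \<in> Sym n \<and>
    (KL_mu n x y \<noteq> 0 \<or> KL_mu n y x \<noteq> 0) \<and> \<not> right_descents n x \<subseteq> right_descents n y"

abbreviation KL_right_le :: "nat \<Rightarrow> (nat \<Rightarrow> nat) \<Rightarrow> (nat \<Rightarrow> nat) \<Rightarrow> bool"
  where "KL_right_le n \<equiv> (KL_right_step n)\<^sup>*\<^sup>*"

definition KL_right_equiv :: "nat \<Rightarrow> (nat \<Rightarrow> nat) \<Rightarrow> (nat \<Rightarrow> nat) \<Rightarrow> bool"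
  where "KL_right_equiv n x y \<longleftrightarrow> KL_right_le n x y \<and> KL_right_le n y x"

section \<open>Compositions and diagrams\<close>

definition composition :: "nat \<Rightarrow> nat list \<Rightarrow> bool"
  where "composition n lam \<longleftrightarrow> 0 \<notin> set lam \<and> sum_list lam = n"

definition J_comp :: "nat list \<Rightarrow> nat set"
  where "J_comp lam = {1..<sum_list lam} - {sum_list (take k lam) | k. 1 \<le> k \<and> k < length lam}"

text \<open>Since rows and columns are numbered from 1, diagrams are taken inside \<open>nat \<times> nat\<close>.\<close>

definition diagram :: "(nat \<times> nat) set \<Rightarrow> bool"
  where "diagram D \<longleftrightarrow> D \<noteq> {} \<and> finite D \<and> (\<exists>r. fst ` D = {1..r}) \<and> (\<exists>c. snd ` D = {1..c})"

definition diagrams :: "nat list \<Rightarrow> (nat \<times> nat) set set"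
  where "diagrams lam = {D. diagram D \<and> fst ` D = {1..length lam} \<and>
    (\<forall>k\<in>{1..length lam}. card {b. (k, b) \<in> D} = lam ! (k - 1))}"

definition row_filling :: "(nat \<times> nat) set \<Rightarrow> nat \<times> nat \<Rightarrow> nat"
  where "row_filling D = (\<lambda>(a, b). card {(a', b') \<in> D. a' < a \<or> (a' = a \<and> b' \<le> b)})"

definition col_filling :: "(nat \<times> nat) set \<Rightarrow> nat \<times> nat \<Rightarrow> nat"
  where "col_filling D = (\<lambda>(a, b). card {(a', b') \<in> D. b' < b \<or> (b' = b \<and> a' \<le> a)})"

definition diag_perm :: "(nat \<times> nat) set \<Rightarrow> nat \<Rightarrow> nat"
  where "diag_perm D =
    (THE w. w \<in> Sym (card D) \<and> (\<forall>v\<in>D. w (row_filling D v) = col_filling D v))"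

definition D_of :: "(nat \<Rightarrow> nat) \<Rightarrow> nat list \<Rightarrow> (nat \<times> nat) set"
  where "D_of d lam = (ARG_MIN (\<lambda>E. card (snd ` E)) E. E \<in> diagrams lam \<and> diag_perm E = d)"

text \<open>In the following, \<open>n\<close> is \<open>sum_list lam\<close>.\<close>

definition Z_set :: "nat list \<Rightarrow> (nat \<Rightarrow> nat) set"
  where "Z_set lam = (let n = sum_list lam; J = J_comp lam in
    {e \<in> min_reps n J. KL_right_equiv n (longest n J \<odot> e) (longest n J)})"

definition Y_set :: "nat list \<Rightarrow> (nat \<Rightarrow> nat) set"
  where "Y_set lam = min_det_set (sum_list lam) (Z_set lam)"

definition E_set :: "nat list \<Rightarrow> (nat \<times> nat) set set"
  where "E_set lam = {D_of y lam | y. y \<in> Y_set lam}"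

definition hat :: "nat \<Rightarrow> (nat \<times> nat) set \<Rightarrow> (nat \<times> nat) set"
  where "hat r D = {(r + 1, 1)} \<union> {(i, j + 1) | i j. (i, j) \<in> D}"

end

theory Submission imports Defs
begin

text \<open>
  \<^bold>\<open>Prefixes.\<close> The whole argument is carried by inversion sets: \<open>x\<close> is a prefix of \<open>y\<close> if and only if every
  inversion of \<open>x\<close> is one of \<open>y\<close> (\<open>is_prefix_iff\<close>). A distinguished representative \<open>x\<close> of a right coset of \<open>S_n\<close>
  in \<open>S_(n+1)\<close> is increasing on \<open>{1..n}\<close>, so for \<open>u\<close> in \<open>S_n\<close> the inversions of \<open>u x\<close> are those of \<open>u\<close> together with
  some pairs \<open>(i, n + 1)\<close> (\<open>inversions_rprod_min_rep\<close>). Thus prefixes in \<open>S_(n+1)\<close> restrict to prefixes of the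
  \<open>S_n\<close>-components, and a right ideal \<open>Z\<close> of \<open>S_n\<close> gives a right ideal of \<open>S_(n+1)\<close>. The longest representative
  \<open>d\<close>, the cycle with \<open>i \<mapsto> i + 1\<close> and \<open>n + 1 \<mapsto> 1\<close>, contributes all the pairs \<open>(i, n + 1)\<close>; therefore
  the maximal elements of the new ideal are the products \<open>y d\<close> with \<open>y\<close> maximal in \<open>Z\<close> (\<open>min_det_set_induced\<close>).

  \<^bold>\<open>Diagrams.\<close> Adding a node in a new last row and a new first column multiplies \<open>w_D\<close> by the same \<open>d\<close>
  (\<open>hat_properties\<close>). With the existence of a diagram for each distinguished representative
  (\<open>diagram_of_min_rep\<close>) this identifies the elements \<open>y d\<close> with those in the theorem.

  \<^bold>\<open>Cells.\<close> The Kazhdan--Lusztig relation enters only in the proof that \<open>Z(\<lambda>)\<close> is a right ideal. If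
  \<open>xs > x\<close> then \<open>P_(x,xs) = 1\<close>, so \<open>xs \<le>\<^sub>R x\<close> (\<open>KL_mu_gen\<close>), and the preorder \<open>\<le>\<^sub>R\<close> reverses the prefix order.
  If \<open>f\<close> is a prefix of \<open>e\<close>, both distinguished, then \<open>w_J f\<close> lies between \<open>w_J\<close> and \<open>w_J e\<close> in the prefix order,
  and so belongs to the same cell as soon as \<open>w_J e\<close> belongs to the cell of \<open>w_J\<close> (\<open>Z_set_prefix_closed\<close>).
\<close>

section \<open>The group and its words\<close>

lemma rprod_apply: "(x \<odot> y) i = y (x i)"
  by (simp add: rprod_def)

lemma rprod_assoc: "x \<odot> y \<odot> z = x \<odot> (y \<odot> z)"
  by (simp add: rprod_def comp_assoc)

lemma rprod_id [simp]: "x \<odot> id = x" "id \<odot> x = x"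
  by (simp_all add: rprod_def)

lemma gen_gen [simp]: "gen k \<odot> gen k = id"
  by (auto simp: gen_def rprod_def)

lemma rprod_gen_gen [simp]: "x \<odot> gen k \<odot> gen k = x" "gen k \<odot> (gen k \<odot> x) = x"
  by (simp add: rprod_assoc, simp flip: rprod_assoc)

lemma gen_apply: "gen k i = (if i = k then Suc k else if i = Suc k then k else i)"
  by (auto simp: gen_def transpose_def)

lemma Sym_rprod: "x \<in> Sym n \<Longrightarrow> y \<in> Sym n \<Longrightarrow> x \<odot> y \<in> Sym n"
  unfolding Sym_def rprod_def using permutes_compose[of x "{1..n}" y] by simp

lemma id_in_Sym [simp]: "id \<in> Sym n"
  by (simp add: Sym_def permutes_id)

lemma gen_in_Sym: "k \<in> {1..<n} \<Longrightarrow> gen k \<in> Sym n"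
  using permutes_swap_id[of k "{1..n}" "Suc k"] by (simp add: Sym_def gen_def)

lemma Sym_mono: "m \<le> n \<Longrightarrow> Sym m \<subseteq> Sym n"
  unfolding Sym_def using permutes_subset[of _ "{1..m}" "{1..n}"] by auto

lemma Sym_inj: "x \<in> Sym n \<Longrightarrow> inj x"
  unfolding Sym_def using permutes_inj by blast

lemma Sym_surj: "x \<in> Sym n \<Longrightarrow> \<exists>p. x p = k"
  unfolding Sym_def using permutes_inverses(1)[of x "{1..n}" k] by blast

lemma Sym_eq_iff: "x \<in> Sym n \<Longrightarrow> x i = x j \<longleftrightarrow> i = j"
  by (rule inj_eq[OF Sym_inj])

lemma Sym_range: "x \<in> Sym n \<Longrightarrow> x i \<in> {1..n} \<longleftrightarrow> i \<in> {1..n}"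
  using permutes_in_image[of x "{1..n}" i] by (simp only: Sym_def mem_Collect_eq)

lemma Sym_outside: "x \<in> Sym n \<Longrightarrow> i \<notin> {1..n} \<Longrightarrow> x i = i"
  unfolding Sym_def mem_Collect_eq by (rule permutes_not_in)

lemma finite_Sym: "finite (Sym n)"
  by (simp add: Sym_def finite_permutations)

lemma word_prod_simps [simp]:
  "word_prod [] = id" "word_prod (k # us) = gen k \<odot> word_prod us"
  by (simp_all add: word_prod_def)

lemma word_prod_append: "word_prod (us @ vs) = word_prod us \<odot> word_prod vs"
  by (induction us) (simp_all only: append.simps word_prod_simps rprod_id rprod_assoc)

lemma word_prod_in_Sym: "set us \<subseteq> {1..<n} \<Longrightarrow> word_prod us \<in> Sym n"
  by (induction us) (auto intro!: Sym_rprod gen_in_Sym)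

lemma word_prod_rev: "word_prod (rev us) \<odot> word_prod us = id"
proof (induction us)
  case (Cons k us)
  have "word_prod (rev (k # us)) \<odot> word_prod (k # us)
      = word_prod (rev us) \<odot> (gen k \<odot> (gen k \<odot> word_prod us))"
    by (simp only: rev.simps word_prod_append word_prod_simps rprod_assoc rprod_id)
  then show ?case using Cons by (simp only: rprod_gen_gen)
qed (simp only: rev.simps word_prod_simps rprod_id)

section \<open>Inversions, length and prefixes\<close>

definition inversions :: "(nat \<Rightarrow> nat) \<Rightarrow> (nat \<times> nat) set"
  where "inversions w = {(i, j). i < j \<and> w j < w i}"

lemma inversions_id [simp]: "inversions id = {}"
  by (auto simp: inversions_def)

lemma inversions_subset: "w \<in> Sym n \<Longrightarrow> inversions w \<subseteq> {1..n} \<times> {1..n}"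
proof
  fix v assume w: "w \<in> Sym n" and "v \<in> inversions w"
  then obtain i j where v: "v = (i, j)" and ij: "i < j" "w j < w i" by (auto simp: inversions_def)
  have j: "j \<in> {1..n}"
  proof (rule ccontr)
    assume "j \<notin> {1..n}"
    with ij w have "j < w i" "n < j" using Sym_outside[OF w, of j] by auto
    then show False using Sym_outside[OF w, of i] Sym_range[OF w, of i] ij by force
  qed
  have "i \<noteq> 0"
    using ij Sym_outside[OF w, of 0] by (cases "i = 0") auto
  then show "v \<in> {1..n} \<times> {1..n}" using j ij v by auto
qed

lemma finite_inversions: "w \<in> Sym n \<Longrightarrow> finite (inversions w)"
  using inversions_subset finite_subset by blast

lemma inversions_gen_up:
  assumes "inj x" "x p = k" "x q = Suc k" "p < q"
  shows "inversions (x \<odot> gen k) = insert (p, q) (inversions x)" "(p, q) \<notin> inversions x"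
proof -
  have 1: "x i = k \<longleftrightarrow> i = p" "x i = Suc k \<longleftrightarrow> i = q" for i
    using assms injD[OF assms(1), of i p] injD[OF assms(1), of i q] by auto
  have 2: "(x \<odot> gen k) i = (if i = p then Suc k else if i = q then k else x i)" for i
    by (simp add: rprod_apply gen_apply 1)
  have 3: "(i, j) \<in> inversions (x \<odot> gen k) \<longleftrightarrow> (i, j) \<in> insert (p, q) (inversions x)" for i j
    using 1[of i] 1[of j] assms unfolding inversions_def mem_Collect_eq case_prod_conv 2 by auto
  then show "inversions (x \<odot> gen k) = insert (p, q) (inversions x)" by auto
  show "(p, q) \<notin> inversions x" using assms by (auto simp: inversions_def)
qed

text \<open>
  The two values \<open>k\<close> and \<open>k + 1\<close> are adjacent, so exchanging them affects the relative order of no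
  other pair of values: \<open>x \<odot> gen k\<close> gains or loses exactly the inversion at the positions of \<open>k\<close> and
  \<open>k + 1\<close>.
\<close>

lemma gen_cases:
  assumes "x \<in> Sym n"
  obtains (up) p q where "x p = k" "x q = Suc k" "p < q"
      "inversions (x \<odot> gen k) = insert (p, q) (inversions x)"
      "card (inversions (x \<odot> gen k)) = Suc (card (inversions x))"
  | (down) p q where "x p = k" "x q = Suc k" "q < p"
      "inversions x = insert (q, p) (inversions (x \<odot> gen k))"
      "card (inversions x) = Suc (card (inversions (x \<odot> gen k)))"
proof -
  obtain p q where pq: "x p = k" "x q = Suc k" using assms Sym_surj by metis
  have inj: "inj x" using assms by (rule Sym_inj)
  have fin: "finite (inversions x)" using assms by (rule finite_inversions)
  have "p \<noteq> q" using pq by auto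
  then consider "p < q" | "q < p" by linarith
  then show ?thesis
  proof cases
    case 1
    show ?thesis using up[OF pq 1] inversions_gen_up[OF inj pq 1] fin by simp
  next
    case 2
    have inj': "inj (x \<odot> gen k)"
      using inj by (simp add: rprod_def gen_def inj_compose)
    have "(x \<odot> gen k) q = k" "(x \<odot> gen k) p = Suc k" using pq by (simp_all add: rprod_apply gen_apply)
    note * = inversions_gen_up[OF inj' this 2]
    have "finite (inversions (x \<odot> gen k))" using fin * by simp
    then show ?thesis using down[OF pq 2] * by simp
  qed
qed

lemma card_inversions_word_le:
  assumes "x \<in> Sym n" "set vs \<subseteq> {1..<n}"
  shows "card (inversions (x \<odot> word_prod vs)) \<le> card (inversions x) + length vs"
  using assms(2)
proof (induction vs rule: rev_induct)
  case (snoc k vs)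
  then have "x \<odot> word_prod vs \<in> Sym n" using assms by (auto intro!: Sym_rprod word_prod_in_Sym)
  then show ?case using snoc
    by (cases rule: gen_cases[where k = k]) (auto simp: word_prod_append rprod_assoc)
qed simp

lemma inversions_word_mono:
  assumes "x \<in> Sym n" "set vs \<subseteq> {1..<n}"
    and "card (inversions (x \<odot> word_prod vs)) = card (inversions x) + length vs"
  shows "inversions x \<subseteq> inversions (x \<odot> word_prod vs)"
  using assms(2,3)
proof (induction vs rule: rev_induct)
  case (snoc k vs)
  then have S: "x \<odot> word_prod vs \<in> Sym n" using assms by (auto intro!: Sym_rprod word_prod_in_Sym)
  have le: "card (inversions (x \<odot> word_prod vs)) \<le> card (inversions x) + length vs"
    using card_inversions_word_le assms(1) snoc.prems by simp
  from S show ?case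
  proof (cases rule: gen_cases[where k = k])
    case (up p q)
    then show ?thesis using snoc le by (auto simp: word_prod_append rprod_assoc)
  next
    case down
    then show ?thesis using snoc le by (auto simp: word_prod_append rprod_assoc)
  qed
qed simp

lemma increasing_Sym_eq_id:
  assumes "g \<in> Sym n" "\<And>k. k \<in> {1..<n} \<Longrightarrow> g k < g (Suc k)"
  shows "g = id"
proof (rule permutes_natset_ge)
  show "g permutes {1..n}" using assms by (simp add: Sym_def)
  have "k \<le> n \<longrightarrow> k \<le> g k" if "1 \<le> k" for k
    using that
  proof (induction k rule: dec_induct)
    case base
    show ?case using Sym_range[OF assms(1), of 1] by auto
  next
    case (step k)
    then show ?case using assms(2)[of k] by auto
  qed
  then show "\<forall>i\<in>{1..n}. i \<le> g i" by auto
qed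

lemma inverse_in_Sym: "x \<in> Sym n \<Longrightarrow> inv x \<in> Sym n"
  by (simp add: Sym_def permutes_inv)

lemma Sym_inverse:
  assumes "x \<in> Sym n" shows "x (inv x k) = k" "inv x (x k) = k"
  using assms by (simp_all add: Sym_def permutes_inverses)

text \<open>
  If no ascent of \<open>x\<close> leads to a permutation whose inversions still lie in those of \<open>y\<close>, then \<open>y\<close>
  orders the positions of the values \<open>k\<close> and \<open>k + 1\<close> of \<open>x\<close> in the same way as \<open>x\<close> does, for every
  \<open>k\<close>. So \<open>y\<close> composed with the inverse of \<open>x\<close> is increasing, hence the identity.
\<close>

lemma weak_order_step:
  assumes x: "x \<in> Sym n" and y: "y \<in> Sym n" and sub: "inversions x \<subseteq> inversions y" and "x \<noteq> y"
  obtains k where "k \<in> {1..<n}" "inversions (x \<odot> gen k) \<subseteq> inversions y"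
    "card (inversions (x \<odot> gen k)) = Suc (card (inversions x))"
proof (rule ccontr)
  assume neg: "\<not> thesis"
  have "inv x \<odot> y = id"
  proof (rule increasing_Sym_eq_id)
    show "inv x \<odot> y \<in> Sym n" using x y by (intro Sym_rprod inverse_in_Sym)
    fix k assume k: "k \<in> {1..<n}"
    from x show "(inv x \<odot> y) k < (inv x \<odot> y) (Suc k)"
    proof (cases rule: gen_cases[where k = k])
      case (up p q)
      have "(p, q) \<notin> inversions y"
      proof
        assume "(p, q) \<in> inversions y"
        then show False using up(4,5) that[of k] neg k sub by simp
      qed
      moreover have "y p \<noteq> y q" using up Sym_eq_iff[OF y] by auto
      ultimately have "y p < y q" using up(3) by (auto simp: inversions_def)
      then show ?thesis using Sym_inverse(2)[OF x, of p] Sym_inverse(2)[OF x, of q] up(1,2)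
        by (simp add: rprod_apply)
    next
      case (down p q)
      then have "(q, p) \<in> inversions y" using sub by auto
      then have "y p < y q" by (auto simp: inversions_def)
      then show ?thesis using Sym_inverse(2)[OF x, of p] Sym_inverse(2)[OF x, of q] down(1,2)
        by (simp add: rprod_apply)
    qed
  qed
  then have "y (inv x (x i)) = x i" for i by (metis id_apply rprod_apply)
  then have "x = y" using Sym_inverse[OF x] by auto
  then show False using \<open>x \<noteq> y\<close> by simp
qed

text \<open>
  The case \<open>x = id\<close> bounds the length by the number of inversions and produces reduced forms; the
  general case turns an inclusion of inversion sets into a prefix relation.
\<close>

lemma weak_order_word:
  assumes "x \<in> Sym n" "y \<in> Sym n" "inversions x \<subseteq> inversions y"
  obtains vs where "set vs \<subseteq> {1..<n}" "y = x \<odot> word_prod vs"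
    "card (inversions y) = card (inversions x) + length vs"
  using assms
proof (induction "card (inversions y) - card (inversions x)" arbitrary: x thesis rule: less_induct)
  case less
  show ?case
  proof (cases "x = y")
    case True
    then show ?thesis using less.prems(1)[of "[]"] by simp
  next
    case False
    then obtain k where k: "k \<in> {1..<n}" "inversions (x \<odot> gen k) \<subseteq> inversions y"
      "card (inversions (x \<odot> gen k)) = Suc (card (inversions x))"
      using weak_order_step less.prems by metis
    have S: "x \<odot> gen k \<in> Sym n" using less.prems k by (intro Sym_rprod gen_in_Sym)
    have "card (inversions (x \<odot> gen k)) \<le> card (inversions y)"
      using k(2) less.prems finite_inversions card_mono by blast
    then have "card (inversions y) - card (inversions (x \<odot> gen k))
        < card (inversions y) - card (inversions x)" using k(3) by linarith
    from less.hyps[OF this _ S less.prems(3) k(2)] obtain vs where vs: "set vs \<subseteq> {1..<n}"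
      "y = x \<odot> gen k \<odot> word_prod vs"
      "card (inversions y) = card (inversions (x \<odot> gen k)) + length vs" by blast
    show ?thesis using less.prems(1)[of "k # vs"] vs k by (simp add: rprod_assoc)
  qed
qed

lemma len_eq:
  assumes "w \<in> Sym n"
  shows "len n w = card (inversions w)"
  unfolding len_def
proof (rule Least_equality)
  show "\<exists>us. set us \<subseteq> {1..<n} \<and> word_prod us = w \<and> length us = card (inversions w)"
    by (rule weak_order_word[of id n w]) (use assms in auto)
  show "card (inversions w) \<le> k"
    if "\<exists>us. set us \<subseteq> {1..<n} \<and> word_prod us = w \<and> length us = k" for k
    using that card_inversions_word_le[of id n] by auto
qed

lemma len_word_le: "set us \<subseteq> {1..<n} \<Longrightarrow> len n (word_prod us) \<le> length us"
  using card_inversions_word_le[of id n us] by (simp add: len_eq word_prod_in_Sym)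

lemma reduced_form_exists:
  assumes "w \<in> Sym n"
  obtains us where "reduced_form n us w"
  by (rule weak_order_word[of id n w]) (use assms in \<open>auto simp: reduced_form_def len_eq\<close>)

text \<open>
  This description of the prefix order does not mention \<open>n\<close> beyond membership in the group, which
  makes it possible to compare prefixes in \<open>S_n\<close> with prefixes in \<open>S_(n+1)\<close>.
\<close>

lemma is_prefix_iff:
  "is_prefix n x y \<longleftrightarrow> x \<in> Sym n \<and> y \<in> Sym n \<and> inversions x \<subseteq> inversions y"
proof
  assume "is_prefix n x y"
  then obtain us vs where us: "reduced_form n us x" and vs: "reduced_form n (us @ vs) y"
    by (auto simp: is_prefix_def)
  have x: "x \<in> Sym n" and y: "y \<in> Sym n" using us vs word_prod_in_Sym
    by (auto simp: reduced_form_def)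
  have "y = x \<odot> word_prod vs" using us vs by (auto simp: reduced_form_def word_prod_append)
  moreover have "card (inversions y) = card (inversions x) + length vs"
    using us vs x y by (auto simp: reduced_form_def len_eq)
  ultimately have "inversions x \<subseteq> inversions y"
    using inversions_word_mono[OF x, of vs] vs by (auto simp: reduced_form_def)
  then show "x \<in> Sym n \<and> y \<in> Sym n \<and> inversions x \<subseteq> inversions y" using x y by simp
next
  assume *: "x \<in> Sym n \<and> y \<in> Sym n \<and> inversions x \<subseteq> inversions y"
  then obtain vs where vs: "set vs \<subseteq> {1..<n}" "y = x \<odot> word_prod vs"
      "card (inversions y) = card (inversions x) + length vs" using weak_order_word by metis
  obtain us where us: "reduced_form n us x" using * reduced_form_exists by blast
  then have "reduced_form n (us @ vs) y"
    using vs * by (auto simp: reduced_form_def len_eq word_prod_append)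
  then show "is_prefix n x y" using us by (auto simp: is_prefix_def)
qed

lemma inversions_eqD:
  assumes "x \<in> Sym n" "y \<in> Sym n" "inversions x = inversions y"
  shows "x = y"
  by (rule weak_order_word[of x n y]) (use assms in auto)

lemma len_rprod_le:
  assumes "x \<in> Sym n" "y \<in> Sym n"
  shows "len n (x \<odot> y) \<le> len n x + len n y"
proof -
  obtain us where "reduced_form n us y" using assms reduced_form_exists by blast
  then show ?thesis using card_inversions_word_le[OF assms(1), of us] assms
    by (auto simp: reduced_form_def len_eq Sym_rprod)
qed

section \<open>Parabolic subgroups and distinguished coset representatives\<close>

lemma parabolic_closed:
  "u \<in> parabolic J \<Longrightarrow> v \<in> parabolic J \<Longrightarrow> u \<odot> v \<in> parabolic J"
  unfolding parabolic_def
proof clarsimp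
  fix us vs assume "set us \<subseteq> J" "set vs \<subseteq> J"
  then show "\<exists>ws. word_prod us \<odot> word_prod vs = word_prod ws \<and> set ws \<subseteq> J"
    by (intro exI[of _ "us @ vs"]) (simp add: word_prod_append)
qed

lemma parabolic_inverse:
  assumes "u \<in> parabolic J"
  obtains v where "v \<in> parabolic J" "v \<odot> u = id"
proof -
  obtain us where us: "u = word_prod us" "set us \<subseteq> J" using assms by (auto simp: parabolic_def)
  have "word_prod (rev us) \<in> parabolic J"
    using us(2) unfolding parabolic_def by (intro CollectI exI[of _ "rev us"]) simp
  then show ?thesis using that us word_prod_rev[of us] by auto
qed

lemma parabolic_subset: "J \<subseteq> {1..<n} \<Longrightarrow> parabolic J \<subseteq> Sym n"
  unfolding parabolic_def using word_prod_in_Sym by blast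

lemma parabolic_full: "parabolic {1..<n} = Sym n"
proof -
  have "w \<in> parabolic {1..<n}" if "w \<in> Sym n" for w
    using reduced_form_exists[OF that] by (auto simp: reduced_form_def parabolic_def)
  then show ?thesis using parabolic_subset by blast
qed

text \<open>
  A word in \<open>J\<close> can interchange two values only after moving one of them across every gap between
  them, and the gap between \<open>k\<close> and \<open>k + 1\<close> is crossed by \<open>s_k\<close> alone.
\<close>

lemma parabolic_inversion_interval:
  assumes "u \<in> parabolic J" "i < j" "u j < u i"
  shows "{u j..<u i} \<subseteq> J"
proof -
  obtain us where us: "u = word_prod us" "set us \<subseteq> J" using assms by (auto simp: parabolic_def)
  from us(2) assms(2,3) show ?thesis unfolding us(1)
  proof (induction us arbitrary: i j rule: rev_induct)
    case (snoc k us)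
    define v where "v = word_prod us"
    have k: "k \<in> J" using snoc.prems by simp
    have eq: "word_prod (us @ [k]) l = gen k (v l)" for l by (simp add: rprod_apply word_prod_append v_def)
    show ?case
    proof (cases "v j < v i")
      case True
      then have IH: "{v j..<v i} \<subseteq> J" using snoc by (simp add: v_def)
      show ?thesis
      proof
        fix l assume "l \<in> {word_prod (us @ [k]) j..<word_prod (us @ [k]) i}"
        then have "l = k \<or> l \<in> {v j..<v i}" unfolding eq gen_apply by (auto split: if_splits)
        then show "l \<in> J" using IH k by blast
      qed
    next
      case False
      then show ?thesis using snoc.prems k unfolding eq gen_apply by (auto split: if_splits)
    qed
  qed simp
qed

lemma increasing_interval:
  fixes e :: "nat \<Rightarrow> nat"
  assumes "\<And>k. k \<in> {a..<b} \<Longrightarrow> e k < e (Suc k)" "a < b"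
  shows "e a < e b"
proof -
  have "a < b" by fact
  then have "Suc a \<le> b" by simp
  then show ?thesis using assms(1)
  proof (induction b rule: dec_induct)
    case base then show ?case by simp
  next
    case (step m)
    then have "e a < e m" by simp
    also have "e m < e (Suc m)" using step by simp
    finally show ?case .
  qed
qed

text \<open>
  The values of an inversion of \<open>u\<close> lie in an interval whose gaps all belong to \<open>J\<close>, and \<open>e\<close> is
  increasing on such an interval; so the inversion survives.
\<close>

lemma inversions_parabolic_rprod:
  assumes "u \<in> parabolic J" "\<And>k. k \<in> J \<Longrightarrow> e k < e (Suc k)"
  shows "inversions u \<subseteq> inversions (u \<odot> e)"
proof -
  have "e (u j) < e (u i)" if "i < j" "u j < u i" for i j
    using increasing_interval[of "u j" "u i" e] parabolic_inversion_interval[OF assms(1) that]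
      assms(2) that by blast
  then show ?thesis by (auto simp: rprod_apply inversions_def)
qed

text \<open>
  Since \<open>u\<close> is a prefix of \<open>u \<odot> e\<close>, cancelling \<open>u\<close> leaves a word for \<open>e\<close> whose length is the difference
  of the two lengths.
\<close>

lemma len_parabolic_rprod_increasing:
  assumes J: "J \<subseteq> {1..<n}" and u: "u \<in> parabolic J" and e: "e \<in> Sym n"
    and inc: "\<And>k. k \<in> J \<Longrightarrow> e k < e (Suc k)"
  shows "len n (u \<odot> e) = len n u + len n e"
proof (rule antisym)
  have uS: "u \<in> Sym n" using J u parabolic_subset by blast
  show "len n (u \<odot> e) \<le> len n u + len n e" using uS e by (rule len_rprod_le)
  have ueS: "u \<odot> e \<in> Sym n" using uS e by (rule Sym_rprod)
  obtain vs where vs: "set vs \<subseteq> {1..<n}" "u \<odot> e = u \<odot> word_prod vs"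
      "card (inversions (u \<odot> e)) = card (inversions u) + length vs"
    using weak_order_word[OF uS ueS inversions_parabolic_rprod] u inc by blast
  obtain v where v: "v \<odot> u = id" using parabolic_inverse[OF u] by blast
  have "e = word_prod vs" using vs(2) v by (metis rprod_assoc rprod_id(2))
  then have "len n e \<le> length vs" using len_word_le vs(1) by simp
  then show "len n u + len n e \<le> len n (u \<odot> e)" using vs(3) by (simp add: len_eq uS ueS)
qed

text \<open>
  A descent at \<open>k \<in> J\<close> would make \<open>s_k\<close> a prefix of \<open>e\<close>, and removing it would give a shorter element
  of the same coset.
\<close>

lemma min_reps_iff:
  assumes J: "J \<subseteq> {1..<n}"
  shows "e \<in> min_reps n J \<longleftrightarrow> e \<in> Sym n \<and> (\<forall>k\<in>J. e k < e (Suc k))"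
proof
  assume "e \<in> Sym n \<and> (\<forall>k\<in>J. e k < e (Suc k))"
  then show "e \<in> min_reps n J"
    using len_parabolic_rprod_increasing[OF J] by (simp add: min_reps_def)
next
  assume e: "e \<in> min_reps n J"
  then have eS: "e \<in> Sym n" by (simp add: min_reps_def)
  have "e k < e (Suc k)" if k: "k \<in> J" for k
  proof (rule ccontr)
    assume "\<not> e k < e (Suc k)"
    then have "e (Suc k) < e k" using Sym_eq_iff[OF eS, of k "Suc k"] by auto
    then have sub: "inversions (gen k) \<subseteq> inversions e" and "inversions (gen k) = {(k, Suc k)}"
      by (auto simp: inversions_def gen_apply split: if_splits)
    moreover have gS: "gen k \<in> Sym n" using J k gen_in_Sym by blast
    ultimately obtain vs where vs: "set vs \<subseteq> {1..<n}" "e = gen k \<odot> word_prod vs"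
      "card (inversions e) = 1 + length vs"
      using weak_order_word[OF gS eS sub] by auto
    have "gen k \<odot> e = word_prod vs" using vs by simp
    then have "len n (gen k \<odot> e) < len n e" using len_word_le[OF vs(1)] vs(3) eS by (simp add: len_eq)
    moreover have "gen k \<in> parabolic J"
      using k unfolding parabolic_def by (intro CollectI exI[of _ "[k]"]) simp
    ultimately show False using e by (auto simp: min_reps_def not_less[symmetric])
  qed
  then show "e \<in> Sym n \<and> (\<forall>k\<in>J. e k < e (Suc k))" using eS by blast
qed

lemma coset_decomposition:
  assumes J: "J \<subseteq> {1..<n}" and y: "y \<in> Sym n"
  obtains u x where "u \<in> parabolic J" "x \<in> min_reps n J" "y = u \<odot> x"
proof -
  have "id \<in> parabolic J" unfolding parabolic_def by (intro CollectI exI[of _ "[]"]) simp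
  then obtain u where u: "u \<in> parabolic J" "\<And>v. v \<in> parabolic J \<Longrightarrow> len n (u \<odot> y) \<le> len n (v \<odot> y)"
    using ex_has_least_nat[of "\<lambda>u. u \<in> parabolic J" id "\<lambda>u. len n (u \<odot> y)"] by blast
  obtain v where v: "v \<in> parabolic J" "v \<odot> u = id" using parabolic_inverse[OF u(1)] by blast
  have "u \<odot> y \<in> Sym n" using u(1) y J parabolic_subset Sym_rprod by blast
  moreover have "len n (u \<odot> y) \<le> len n (w \<odot> (u \<odot> y))" if "w \<in> parabolic J" for w
    using u that parabolic_closed[OF that u(1)] by (simp flip: rprod_assoc)
  ultimately have "u \<odot> y \<in> min_reps n J" by (simp add: min_reps_def)
  moreover have "y = v \<odot> (u \<odot> y)" using v by (simp flip: rprod_assoc)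
  ultimately show ?thesis using that v by blast
qed

lemma longest_in_parabolic:
  assumes "J \<subseteq> {1..<n}"
  shows "longest n J \<in> parabolic J"
proof -
  have id: "id \<in> parabolic J" unfolding parabolic_def by (intro CollectI exI[of _ "[]"]) simp
  have fin: "finite (parabolic J)" using parabolic_subset[OF assms] finite_Sym finite_subset by blast
  have "\<forall>w. w \<in> parabolic J \<longrightarrow> len n w \<le> Max (len n ` parabolic J)" using fin by simp
  then show ?thesis
    unfolding longest_def
    using arg_max_natI[of "\<lambda>w. w \<in> parabolic J", OF id, of "len n" "Suc (Max (len n ` parabolic J))"]
    by (simp add: less_Suc_eq_le)
qed

section \<open>Weak order and the Kazhdan--Lusztig preorder\<close>

lemma transpose_gen:
  "Transposition.transpose a b \<odot> gen k
    = gen k \<odot> Transposition.transpose (gen k a) (gen k b)"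
proof
  fix c
  have "gen k a = gen k b \<longleftrightarrow> a = b" for a b by (auto simp: gen_apply)
  then show "(Transposition.transpose a b \<odot> gen k) c
    = (gen k \<odot> Transposition.transpose (gen k a) (gen k b)) c"
    by (simp add: rprod_apply transpose_def)
qed

text \<open>
  The strong exchange condition. Reading the word from its end, either the last letter creates the
  inversion, and deleting it undoes the transposition of the two values, or the transposition can be
  conjugated past that letter.
\<close>

lemma exchange:
  assumes "(i, j) \<in> inversions (word_prod us)"
  shows "\<exists>us1 k us2. us = us1 @ k # us2 \<and>
    word_prod us \<odot> Transposition.transpose (word_prod us i) (word_prod us j) = word_prod (us1 @ us2)"
  using assms
proof (induction us rule: rev_induct)
  case (snoc k us)
  define v where "v = word_prod us"
  have w: "word_prod (us @ [k]) = v \<odot> gen k" by (simp only: word_prod_append word_prod_simps rprod_id v_def)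
  have wi: "word_prod (us @ [k]) l = gen k (v l)" for l by (simp add: w rprod_apply)
  show ?case
  proof (cases "(i, j) \<in> inversions v")
    case True
    then obtain us1 l us2 where "us = us1 @ l # us2"
        and *: "v \<odot> Transposition.transpose (v i) (v j) = word_prod (us1 @ us2)"
      using snoc.IH v_def by blast
    then have "us @ [k] = us1 @ l # (us2 @ [k])" by simp
    moreover have "word_prod (us @ [k]) \<odot>
        Transposition.transpose (word_prod (us @ [k]) i) (word_prod (us @ [k]) j)
        = word_prod (us1 @ us2 @ [k])"
    proof -
      have "v \<odot> gen k \<odot> Transposition.transpose (gen k (v i)) (gen k (v j))
          = v \<odot> Transposition.transpose (v i) (v j) \<odot> gen k"
        by (simp only: rprod_assoc transpose_gen)
      also have "\<dots> = word_prod (us1 @ us2) \<odot> gen k" by (simp only: *)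
      also have "\<dots> = word_prod (us1 @ us2 @ [k])"
        by (simp only: word_prod_append word_prod_simps rprod_id rprod_assoc)
      finally show ?thesis by (simp only: w wi[unfolded w])
    qed
    ultimately show ?thesis by blast
  next
    case False
    have "i < j" "gen k (v j) < gen k (v i)" using snoc.prems by (auto simp: inversions_def wi)
    moreover have "\<not> v j < v i" using False \<open>i < j\<close> by (auto simp: inversions_def)
    ultimately have "v i = k" "v j = Suc k" by (auto simp: gen_apply split: if_splits)
    then have "Transposition.transpose (gen k (v i)) (gen k (v j)) = gen k"
      by (simp add: gen_def transpose_commute)
    then have "word_prod (us @ [k]) \<odot>
        Transposition.transpose (word_prod (us @ [k]) i) (word_prod (us @ [k]) j) = word_prod (us @ [])"
      unfolding wi[of i] wi[of j] by (simp only: w rprod_gen_gen append_Nil2 v_def)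
    then show ?thesis by blast
  qed
qed (auto simp: inversions_def)

lemma len_gen_cases:
  assumes x: "x \<in> Sym n" and k: "k \<in> {1..<n}"
  obtains (descent) "k \<in> right_descents n x" "len n x = Suc (len n (x \<odot> gen k))"
  | (ascent) "k \<notin> right_descents n x" "len n (x \<odot> gen k) = Suc (len n x)"
proof -
  have S: "x \<odot> gen k \<in> Sym n" using x k by (intro Sym_rprod gen_in_Sym)
  from x show thesis
  proof (cases rule: gen_cases[where k = k])
    case up
    then have "len n (x \<odot> gen k) = Suc (len n x)" by (simp only: len_eq[OF x] len_eq[OF S])
    then show ?thesis using ascent by (simp add: right_descents_def)
  next
    case down
    then have "len n x = Suc (len n (x \<odot> gen k))" by (simp only: len_eq[OF x] len_eq[OF S])
    then show ?thesis using descent k by (simp add: right_descents_def)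
  qed
qed

lemma len_id [simp]: "len n id = 0"
  by (simp only: len_eq[OF id_in_Sym] inversions_id card.empty)

text \<open>
  The next three lemmas evaluate the recursion for \<open>R\<close> along an arbitrary word, when the word is
  shorter than \<open>x\<close>, as long as \<open>x\<close>, or longer by one letter. Working with all words is necessary because
  the reduced form of \<open>w\<close> used in the definition of \<open>R_(x,w)\<close> is an unspecified one. The words are written
  backwards, in the order in which the recursion consumes them.
\<close>

lemma R_word_eq_0:
  assumes "set us \<subseteq> {1..<n}" "x \<in> Sym n" "length us < len n x"
  shows "R_word n us x = 0"
  using assms
proof (induction us arbitrary: x)
  case Nil
  then show ?case by (cases "x = id") auto
next
  case (Cons i us)
  have i: "i \<in> {1..<n}" and us: "set us \<subseteq> {1..<n}" using Cons.prems by auto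
  have S: "x \<odot> gen i \<in> Sym n" using Cons.prems i by (intro Sym_rprod gen_in_Sym)
  from Cons.prems(2) i show ?case
  proof (cases rule: len_gen_cases)
    case descent
    then show ?thesis using Cons.IH[OF us S] Cons.prems by simp
  next
    case ascent
    then show ?thesis using Cons.IH[OF us S] Cons.IH[OF us Cons.prems(2)] Cons.prems by simp
  qed
qed

lemma rprod_gen_eq_iff: "x \<odot> gen i = y \<longleftrightarrow> x = y \<odot> gen i"
  by (metis rprod_gen_gen(1))

lemma word_prod_rev_Cons: "word_prod (rev (i # us)) = word_prod (rev us) \<odot> gen i"
  by (simp only: rev.simps word_prod_append word_prod_simps rprod_id)

lemma R_word_length_eq_len:
  assumes "set us \<subseteq> {1..<n}" "x \<in> Sym n" "length us = len n x"
  shows "R_word n us x = (if x = word_prod (rev us) then 1 else 0)"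
  using assms
proof (induction us arbitrary: x)
  case Nil
  show ?case by (simp only: R_word.simps rev.simps word_prod_simps)
next
  case (Cons i us)
  have i: "i \<in> {1..<n}" and us: "set us \<subseteq> {1..<n}" using Cons.prems by auto
  have S: "x \<odot> gen i \<in> Sym n" using Cons.prems i by (intro Sym_rprod gen_in_Sym)
  from Cons.prems(2) i show ?case
  proof (cases rule: len_gen_cases)
    case descent
    then have "R_word n (i # us) x = (if x \<odot> gen i = word_prod (rev us) then 1 else 0)"
      using Cons.IH[OF us S] Cons.prems by simp
    then show ?thesis by (simp only: word_prod_rev_Cons rprod_gen_eq_iff)
  next
    case ascent
    have "x \<odot> gen i \<noteq> word_prod (rev us)"
      using len_word_le[of "rev us" n] us ascent Cons.prems by auto
    then have "x \<noteq> word_prod (rev (i # us))" by (metis word_prod_rev_Cons rprod_gen_eq_iff)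
    moreover have "R_word n (i # us) x = 0"
      using ascent R_word_eq_0[OF us S] R_word_eq_0[OF us Cons.prems(2)] Cons.prems by simp
    ultimately show ?thesis by simp
  qed
qed

text \<open>
  As long as the letter read is not the deleted one, it is a descent both of \<open>x\<close> and of the full product,
  and the recursion cancels it from both. At the deleted letter \<open>x\<close> has an ascent, and of the two summands
  of the recursion only \<open>(q - 1) R_(x,x)\<close> is non-zero.
\<close>

lemma R_word_delete_letter:
  assumes "set (us1 @ k # us2) \<subseteq> {1..<n}"
    and "length (us1 @ k # us2) = len n (word_prod (rev (us1 @ k # us2)))"
    and "Suc (len n (word_prod (rev (us1 @ us2)))) = length (us1 @ k # us2)"
  shows "R_word n (us1 @ k # us2) (word_prod (rev (us1 @ us2))) = [:-1, 1:]"
  using assms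
proof (induction us1)
  case Nil
  define x where "x = word_prod (rev us2)"
  have k: "k \<in> {1..<n}" and us2: "set us2 \<subseteq> {1..<n}" using Nil by auto
  have x: "x \<in> Sym n" unfolding x_def using us2 by (intro word_prod_in_Sym) simp
  have S: "x \<odot> gen k \<in> Sym n" using x k by (intro Sym_rprod gen_in_Sym)
  have len: "len n (x \<odot> gen k) = Suc (length us2)" "len n x = length us2"
    using Nil.prems(2,3) unfolding append_Nil word_prod_rev_Cons x_def by simp_all
  have "k \<notin> right_descents n x" using x k len by (cases rule: len_gen_cases) auto
  moreover have "R_word n us2 (x \<odot> gen k) = 0" using R_word_eq_0[OF us2 S] len by simp
  moreover have "R_word n us2 x = 1" using R_word_length_eq_len[OF us2 x] len x_def by simp
  ultimately show ?case by (simp flip: x_def)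
next
  case (Cons i us1)
  define x where "x = word_prod (rev (us1 @ us2))"
  define w where "w = word_prod (rev (us1 @ k # us2))"
  have i: "i \<in> {1..<n}" and us: "set (us1 @ k # us2) \<subseteq> {1..<n}" "set (us1 @ us2) \<subseteq> {1..<n}"
    using Cons.prems by auto
  have x: "x \<in> Sym n" unfolding x_def using us by (intro word_prod_in_Sym) auto
  have w: "w \<in> Sym n" unfolding w_def using us by (intro word_prod_in_Sym) auto
  have S: "x \<odot> gen i \<in> Sym n" using x i by (intro Sym_rprod gen_in_Sym)
  have lens: "len n (w \<odot> gen i) = length (i # us1 @ k # us2)"
    "Suc (len n (x \<odot> gen i)) = length (i # us1 @ k # us2)"
    using Cons.prems(2,3) unfolding append_Cons word_prod_rev_Cons x_def w_def by simp_all
  have "len n w \<le> length (us1 @ k # us2)"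
    unfolding w_def using len_word_le[of "rev (us1 @ k # us2)" n] us by simp
  with w i have lw: "length (us1 @ k # us2) = len n w"
    using lens by (cases rule: len_gen_cases) auto
  have lx: "len n x \<le> length (us1 @ us2)"
    unfolding x_def using len_word_le[of "rev (us1 @ us2)" n] us by simp
  have lx': "Suc (len n x) = length (us1 @ k # us2)" and d: "i \<in> right_descents n (x \<odot> gen i)"
    using S i lx lens by (cases rule: len_gen_cases; simp)+
  have "R_word n (i # us1 @ k # us2) (x \<odot> gen i) = R_word n (us1 @ k # us2) x"
    using d by simp
  also have "\<dots> = [:-1, 1:]"
    using Cons.IH[OF us(1)] lw lx' unfolding w_def x_def by simp
  finally show ?case unfolding append_Cons word_prod_rev_Cons x_def .
qed

text \<open>
  By the exchange condition, every reduced form of \<open>xs\<close> becomes a word for \<open>x\<close> after the deletion of one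
  letter.
\<close>

lemma R_poly_gen:
  assumes x: "x \<in> Sym n" and k: "k \<in> {1..<n}" and asc: "k \<notin> right_descents n x"
  shows "R_poly n x (x \<odot> gen k) = [:-1, 1:]"
proof -
  define w where "w = x \<odot> gen k"
  define us where "us = (SOME us. reduced_form n us w)"
  have w: "w \<in> Sym n" unfolding w_def using x k by (intro Sym_rprod gen_in_Sym)
  have len: "len n w = Suc (len n x)" using x k asc unfolding w_def
    by (cases rule: len_gen_cases) auto
  have "reduced_form n us w"
    unfolding us_def using reduced_form_exists[OF w] by (metis someI_ex)
  then have us: "set us \<subseteq> {1..<n}" "word_prod us = w" "length us = len n w"
    by (simp_all add: reduced_form_def)
  from x obtain p q where pq: "x p = k" "x q = Suc k" "p < q"
    using len len_eq[OF w] len_eq[OF x] by (cases rule: gen_cases[where k = k]) (auto simp: w_def)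
  then have wpq: "w p = Suc k" "w q = k" by (simp_all add: w_def rprod_apply gen_apply)
  then have "(p, q) \<in> inversions (word_prod us)" using pq us by (simp add: inversions_def)
  from exchange[OF this] obtain us1 l us2 where
    split: "us = us1 @ l # us2" and "w \<odot> gen k = word_prod (us1 @ us2)"
    using us(2) wpq by (metis gen_def transpose_commute)
  then have x_eq: "x = word_prod (us1 @ us2)" by (simp add: w_def)
  have "R_word n (rev us2 @ l # rev us1) (word_prod (rev (rev us2 @ rev us1))) = [:-1, 1:]"
    by (rule R_word_delete_letter) (use us split len x_eq in auto)
  then have "R_word n (rev us) x = [:-1, 1:]" by (simp add: split x_eq)
  then show ?thesis by (simp only: R_poly_def us_def w_def)
qed

lemma q_bar_one_const: "q_bar 1 [:c:] = [:0, c:]"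
  by (simp add: q_bar_def monom_altdef)

text \<open>
  There is nothing strictly between \<open>x\<close> and \<open>xs\<close>, so \<open>P_(x,xs)\<close> is the constant \<open>c\<close> with
  \<open>c q - c = R_(x,xs) = q - 1\<close>.
\<close>

lemma KL_mu_gen:
  assumes x: "x \<in> Sym n" and k: "k \<in> {1..<n}" and asc: "k \<notin> right_descents n x"
  shows "KL_mu n x (x \<odot> gen k) = 1"
proof -
  define w where "w = x \<odot> gen k"
  have len: "len n w = Suc (len n x)" using x k asc unfolding w_def
    by (cases rule: len_gen_cases) auto
  have "bruhat_step n x w"
    unfolding bruhat_step_def
  proof (intro conjI bexI)
    show "w = x \<odot> Transposition.transpose k (Suc k)" by (simp only: w_def gen_def)
  qed (use x k len in auto)
  then have less: "bruhat_less n x w" by blast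
  have interval: "{y. bruhat_less n x y \<and> bruhat_le n y w} = {w}"
  proof -
    have "y = w" if "bruhat_less n x y" "bruhat_le n y w" for y
      using bruhat_less_len[OF that(1)] rtranclpD[OF that(2)] bruhat_less_len[of n y w] len by auto
    then show ?thesis using less by auto
  qed
  have "x \<noteq> w" using len by auto
  have KL_w: "KL_poly n w w = 1" by (subst KL_poly.simps) simp
  have "KL_poly n x w = (THE p. 2 * degree p + 1 \<le> len n w - len n x \<and>
           q_bar (len n w - len n x) p - p =
           (\<Sum>y\<in>{y. bruhat_less n x y \<and> bruhat_le n y w}. R_poly n x y * KL_poly n y w))"
    by (subst KL_poly.simps) (simp only: \<open>x \<noteq> w\<close> less if_True if_False)
  also have "\<dots> = (THE p. degree p = 0 \<and> q_bar 1 p - p = [:-1, 1:])"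
    unfolding interval using len KL_w R_poly_gen[OF assms, folded w_def] by simp
  also have "\<dots> = 1"
  proof (rule the_equality)
    show "degree (1 :: int poly) = 0 \<and> q_bar 1 1 - 1 = [:-1, 1 :: int:]"
      using q_bar_one_const[of 1] by (simp add: one_pCons)
    fix p :: "int poly" assume p: "degree p = 0 \<and> q_bar 1 p - p = [:-1, 1:]"
    then obtain c where "p = [:c:]" using degree_eq_zeroE by blast
    then show "p = 1" using p q_bar_one_const[of c] by (simp add: one_pCons)
  qed
  finally have "KL_poly n x w = 1" .
  then show ?thesis using less len by (simp add: KL_mu_def flip: w_def)
qed

lemma KL_right_step_gen:
  assumes x: "x \<in> Sym n" and k: "k \<in> {1..<n}" and asc: "k \<notin> right_descents n x"
  shows "KL_right_step n (x \<odot> gen k) x"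
proof -
  have S: "x \<odot> gen k \<in> Sym n" using x k by (intro Sym_rprod gen_in_Sym)
  have "len n (x \<odot> gen k) = Suc (len n x)" using x k asc by (cases rule: len_gen_cases) auto
  with S k have "k \<in> right_descents n (x \<odot> gen k)" by (cases rule: len_gen_cases) auto
  then show ?thesis using KL_mu_gen[OF assms] x S asc by (auto simp: KL_right_step_def)
qed

lemma KL_right_le_if_prefix:
  assumes "is_prefix n x y"
  shows "KL_right_le n y x"
proof -
  have xy: "x \<in> Sym n" "y \<in> Sym n" "inversions x \<subseteq> inversions y"
    using assms by (auto simp: is_prefix_iff)
  then obtain vs where vs: "set vs \<subseteq> {1..<n}" "y = x \<odot> word_prod vs"
    "card (inversions y) = card (inversions x) + length vs" using weak_order_word by metis
  have "set vs \<subseteq> {1..<n} \<Longrightarrow> len n (x \<odot> word_prod vs) = len n x + length vs \<Longrightarrow>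
      KL_right_le n (x \<odot> word_prod vs) x" for vs
  proof (induction vs rule: rev_induct)
    case (snoc k vs)
    define v where "v = x \<odot> word_prod vs"
    have k: "k \<in> {1..<n}" and vs: "set vs \<subseteq> {1..<n}" using snoc by auto
    have v: "v \<in> Sym n" unfolding v_def using xy vs by (intro Sym_rprod word_prod_in_Sym)
    have eq: "x \<odot> word_prod (vs @ [k]) = v \<odot> gen k"
      by (simp only: v_def word_prod_append word_prod_simps rprod_id rprod_assoc)
    have le: "len n v \<le> len n x + length vs"
      using len_rprod_le[OF xy(1) word_prod_in_Sym[OF vs]] len_word_le[OF vs] by (simp add: v_def)
    have len: "len n (v \<odot> gen k) = len n x + length vs + 1" using snoc.prems(2) eq by simp
    have "k \<notin> right_descents n v" "len n v = len n x + length vs"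
      using v k le len by (cases rule: len_gen_cases; simp)+
    then show ?case using KL_right_step_gen[OF v k] snoc.IH vs unfolding eq v_def[symmetric]
      by (metis converse_rtranclp_into_rtranclp v_def)
  qed (simp only: word_prod_simps rprod_id rtranclp.rtrancl_refl)
  then show ?thesis using vs xy by (metis len_eq)
qed

text \<open>
  Let \<open>w\<close> be the longest element of \<open>W_J\<close>. As the lengths in \<open>w e\<close> and \<open>w f\<close> add up, \<open>w\<close> is a prefix of
  \<open>w f\<close>, which is a prefix of \<open>w e\<close>. So \<open>w e \<le>\<^sub>R w f \<le>\<^sub>R w\<close>, and \<open>w \<le>\<^sub>R w e\<close> closes the cycle.
\<close>

lemma Z_set_prefix_closed:
  assumes J: "J \<subseteq> {1..<n}"
    and e: "e \<in> min_reps n J" "KL_right_equiv n (longest n J \<odot> e) (longest n J)"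
    and f: "is_prefix n f e"
  shows "f \<in> min_reps n J \<and> KL_right_equiv n (longest n J \<odot> f) (longest n J)"
proof -
  let ?w = "longest n J"
  have eS: "e \<in> Sym n" and fS: "f \<in> Sym n" and sub: "inversions f \<subseteq> inversions e"
    using f by (auto simp: is_prefix_iff)
  have inc_e: "e k < e (Suc k)" if "k \<in> J" for k using e that by (simp add: min_reps_iff[OF J])
  have inc_f: "f k < f (Suc k)" if k: "k \<in> J" for k
  proof (rule ccontr)
    assume "\<not> f k < f (Suc k)"
    then have "f (Suc k) < f k" using Sym_eq_iff[OF fS, of k "Suc k"] by auto
    then have "(k, Suc k) \<in> inversions e" using sub by (auto simp: inversions_def)
    then show False using inc_e[OF k] by (simp add: inversions_def)
  qed
  have w: "?w \<in> parabolic J" using J by (rule longest_in_parabolic)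
  then have wS: "?w \<in> Sym n" using parabolic_subset[OF J] by blast
  obtain vs where vs: "set vs \<subseteq> {1..<n}" "e = f \<odot> word_prod vs"
    "card (inversions e) = card (inversions f) + length vs" using weak_order_word eS fS sub by metis
  have wfS: "?w \<odot> f \<in> Sym n" and weS: "?w \<odot> e \<in> Sym n" using wS eS fS by (auto intro: Sym_rprod)
  have "len n (?w \<odot> e) = len n (?w \<odot> f) + length vs"
    using len_parabolic_rprod_increasing[OF J w eS inc_e]
      len_parabolic_rprod_increasing[OF J w fS inc_f] vs(3)
    by (simp add: len_eq eS fS)
  then have "inversions (?w \<odot> f) \<subseteq> inversions (?w \<odot> e)"
    using inversions_word_mono[OF wfS vs(1)] vs(2) wfS weS by (simp add: len_eq rprod_assoc)
  then have "KL_right_le n (?w \<odot> e) (?w \<odot> f)"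
    using wfS weS by (intro KL_right_le_if_prefix) (simp add: is_prefix_iff)
  moreover have "KL_right_le n (?w \<odot> f) ?w"
    using inversions_parabolic_rprod[OF w, of f] inc_f wfS wS
    by (intro KL_right_le_if_prefix) (simp add: is_prefix_iff)
  ultimately show ?thesis
    using e(2) inc_f fS by (auto simp: KL_right_equiv_def min_reps_iff[OF J])
qed

lemma Z_set_right_ideal: "right_ideal (sum_list lam) (Z_set lam)"
proof -
  have J: "J_comp lam \<subseteq> {1..<sum_list lam}" by (auto simp: J_comp_def)
  show ?thesis
    unfolding right_ideal_def
  proof (intro conjI ballI impI)
    show "Z_set lam \<subseteq> Sym (sum_list lam)" by (auto simp: Z_set_def Let_def min_reps_def)
    fix e f assume "e \<in> Z_set lam" "is_prefix (sum_list lam) f e"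
    then show "f \<in> Z_set lam" using Z_set_prefix_closed[OF J, of e f] by (simp add: Z_set_def Let_def)
  qed
qed

section \<open>Inducing a right ideal to the next symmetric group\<close>

text \<open>
  The longest distinguished coset representative \<open>s_n \<cdots> s_1\<close>.
\<close>

definition long_cycle :: "nat \<Rightarrow> nat \<Rightarrow> nat"
  where "long_cycle n i = (if i \<in> {1..n} then Suc i else if i = Suc n then 1 else i)"

lemma long_cycle_min_rep: "long_cycle n \<in> min_reps (n + 1) {1..<n}"
proof -
  have "bij_betw (long_cycle n) {1..n + 1} {1..n + 1}"
    by (rule bij_betw_byWitness[where f' = "\<lambda>i. if i = 1 then Suc n else i - 1"])
      (auto simp: long_cycle_def)
  then have "long_cycle n permutes {1..n + 1}"
    by (rule bij_imp_permutes) (auto simp: long_cycle_def)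
  moreover have "{1..<n} \<subseteq> {1..<n + 1}" by auto
  ultimately show ?thesis by (simp add: min_reps_iff Sym_def) (simp add: long_cycle_def)
qed

lemma min_rep_less_iff:
  assumes x: "x \<in> min_reps (n + 1) {1..<n}" and ab: "a \<in> {1..n}" "b \<in> {1..n}"
  shows "x a < x b \<longleftrightarrow> a < b"
proof -
  have "{1..<n} \<subseteq> {1..<n + 1}" by auto
  then have inc: "x k < x (Suc k)" if "k \<in> {1..<n}" for k
    using x that by (simp add: min_reps_iff)
  have "x i < x j" if "i < j" "1 \<le> i" "j \<le> n" for i j
    using increasing_interval[of i j x] inc that by simp
  then show ?thesis using ab by (metis atLeastAtMost_iff linorder_neqE_nat order_less_asym)
qed

text \<open>
  Since \<open>x\<close> is increasing on \<open>{1..n}\<close>, it neither creates nor destroys inversions of \<open>u\<close> among the first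
  \<open>n\<close> positions. So the inversions of \<open>u \<odot> x\<close> inside \<open>{1..n}\<close> depend on \<open>u\<close> alone.
\<close>

lemma inversions_rprod_min_rep:
  assumes u: "u \<in> Sym n" and x: "x \<in> min_reps (n + 1) {1..<n}"
  shows "inversions (u \<odot> x) = inversions u \<union> {(i, n + 1) | i. i \<in> {1..n} \<and> x (n + 1) < x (u i)}"
proof (intro set_eqI)
  fix v :: "nat \<times> nat"
  obtain i j where v: "v = (i, j)" by (cases v)
  have xS: "x \<in> Sym (n + 1)" using x by (simp add: min_reps_def)
  have uS: "u \<in> Sym (n + 1)" using u Sym_mono[of n "n + 1"] by auto
  have uxS: "u \<odot> x \<in> Sym (n + 1)" using uS xS by (rule Sym_rprod)
  have range: "(i, j) \<in> inversions (u \<odot> x) \<Longrightarrow> i \<in> {1..n + 1} \<and> j \<in> {1..n + 1} \<and> i < j"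
    using inversions_subset[OF uxS] by (auto simp: inversions_def)
  have un: "u (n + 1) = n + 1" using Sym_outside[OF u, of "n + 1"] by simp
  consider "i \<in> {1..n}" "j \<in> {1..n}" | "i \<in> {1..n}" "j = n + 1" | "\<not> (i \<in> {1..n} \<and> j \<in> {1..n + 1})"
    by fastforce
  then show "v \<in> inversions (u \<odot> x) \<longleftrightarrow>
      v \<in> inversions u \<union> {(i, n + 1) | i. i \<in> {1..n} \<and> x (n + 1) < x (u i)}"
  proof cases
    case 1
    then have "u i \<in> {1..n}" "u j \<in> {1..n}" using Sym_range[OF u, of i] Sym_range[OF u, of j] by auto
    then show ?thesis using 1 v min_rep_less_iff[OF x, of "u j" "u i"]
      by (simp add: inversions_def rprod_apply)
  next
    case 2
    then have "(i, j) \<notin> inversions u" using inversions_subset[OF u] by auto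
    then show ?thesis using 2 v un by (auto simp: inversions_def rprod_apply)
  next
    case 3
    then have "(i, j) \<notin> inversions (u \<odot> x)" using range by auto
    moreover have "(i, j) \<notin> inversions u" using 3 inversions_subset[OF u] by auto
    ultimately show ?thesis using 3 v by auto
  qed
qed

lemma inversions_rprod_long_cycle:
  assumes u: "u \<in> Sym n"
  shows "inversions (u \<odot> long_cycle n) = inversions u \<union> {1..n} \<times> {n + 1}"
proof -
  have "long_cycle n (n + 1) < long_cycle n (u i)" if "i \<in> {1..n}" for i
    using Sym_range[OF u, of i] that by (auto simp: long_cycle_def)
  then show ?thesis using inversions_rprod_min_rep[OF u long_cycle_min_rep] by auto
qed

text \<open>
  A prefix of \<open>z \<odot> x\<close> has the form \<open>u \<odot> x'\<close>, and restricting the inclusion of inversion sets to pairs inside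
  \<open>{1..n}\<close> shows that \<open>u\<close> is a prefix of \<open>z\<close>.
\<close>

lemma right_ideal_induced:
  assumes Z: "right_ideal n Z"
  defines "X \<equiv> min_reps (n + 1) {1..<n}"
  shows "right_ideal (n + 1) (set_prod Z X)"
proof -
  have ZS: "Z \<subseteq> Sym n" using Z by (simp add: right_ideal_def)
  have XS: "X \<subseteq> Sym (n + 1)" by (auto simp: X_def min_reps_def)
  have "set_prod Z X \<subseteq> Sym (n + 1)"
    using ZS XS Sym_mono[of n "n + 1"] unfolding set_prod_def by (auto intro!: Sym_rprod)
  moreover have "y \<in> set_prod Z X"
    if zx: "zx \<in> set_prod Z X" and y: "y \<in> Sym (n + 1)" and pre: "is_prefix (n + 1) y zx" for zx y
  proof -
    obtain z x where z: "z \<in> Z" and x: "x \<in> X" and zx_eq: "zx = z \<odot> x"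
      using zx by (auto simp: set_prod_def)
    obtain u x' where "u \<in> parabolic {1..<n}" and x': "x' \<in> X" and y_eq: "y = u \<odot> x'"
      using coset_decomposition[of "{1..<n}" "n + 1" y] y unfolding X_def by auto
    then have u: "u \<in> Sym n" by (simp only: parabolic_full)
    have zS: "z \<in> Sym n" using z ZS by auto
    have "inversions (u \<odot> x') \<subseteq> inversions (z \<odot> x)" using pre by (simp add: is_prefix_iff zx_eq y_eq)
    then have "inversions u \<subseteq> inversions z"
      using inversions_rprod_min_rep[OF u x'[unfolded X_def]]
        inversions_rprod_min_rep[OF zS x[unfolded X_def]] inversions_subset[OF u] by auto
    then have "u \<in> Z" using Z z u zS by (auto simp: right_ideal_def is_prefix_iff)
    then show ?thesis using x' y_eq by (auto simp: set_prod_def)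
  qed
  ultimately show ?thesis by (auto simp: right_ideal_def)
qed

lemma min_det_set_dominates:
  assumes "Z \<subseteq> Sym n" "z \<in> Z"
  obtains y where "y \<in> min_det_set n Z" "is_prefix n z y"
proof -
  let ?P = "\<lambda>y. y \<in> Z \<and> is_prefix n z y"
  have "?P z" using assms by (auto simp: is_prefix_iff)
  moreover have "\<forall>y. ?P y \<longrightarrow> len n y \<le> Max (len n ` Z)"
    using finite_subset[OF assms(1) finite_Sym] by simp
  ultimately obtain y where y: "?P y" "\<And>y'. ?P y' \<Longrightarrow> len n y' \<le> len n y"
    using ex_has_greatest_nat[of ?P z "len n"] by (metis less_Suc_eq_le)
  have "y' = y" if "y' \<in> Z" "is_prefix n y y'" for y'
  proof -
    have sub: "inversions y \<subseteq> inversions y'" and S: "y \<in> Sym n" "y' \<in> Sym n"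
      using that by (auto simp: is_prefix_iff)
    have "?P y'" using that y by (auto simp: is_prefix_iff)
    then have "card (inversions y') \<le> card (inversions y)" using y(2)[of y'] S by (simp add: len_eq)
    then have "inversions y = inversions y'" using sub finite_inversions[OF S(2)] card_seteq by blast
    then show ?thesis using inversions_eqD S by blast
  qed
  then have "y \<in> min_det_set n Z" using y by (auto simp: min_det_set_def)
  then show ?thesis using that y by blast
qed

text \<open>
  The representative \<open>long_cycle n\<close> makes all pairs \<open>(i, n + 1)\<close> inversions. Hence, for a maximal prefix
  extension \<open>y\<close> of \<open>z\<close> in \<open>Z\<close>, every \<open>z \<odot> x\<close> is a prefix of \<open>y \<odot> long_cycle n\<close>. Conversely, an element above
  \<open>y \<odot> long_cycle n\<close> has an \<open>S_n\<close>-component above \<open>y\<close> and all pairs \<open>(i, n + 1)\<close> as inversions.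
\<close>

lemma min_det_set_induced:
  assumes ZS: "Z \<subseteq> Sym n"
  defines "X \<equiv> min_reps (n + 1) {1..<n}"
  shows "min_det_set (n + 1) (set_prod Z X) = (\<lambda>y. y \<odot> long_cycle n) ` min_det_set n Z"
proof -
  let ?d = "long_cycle n"
  have XS: "X \<subseteq> Sym (n + 1)" by (auto simp: X_def min_reps_def)
  have S': "u \<odot> x \<in> Sym (n + 1)" if "u \<in> Sym n" "x \<in> X" for u x
    using that XS Sym_mono[of n "n + 1"] by (auto intro!: Sym_rprod)
  have d: "?d \<in> X" unfolding X_def by (rule long_cycle_min_rep)
  have inv: "inversions (u \<odot> x) = inversions u \<union> {(i, n + 1) | i. i \<in> {1..n} \<and> x (n + 1) < x (u i)}"
    if "u \<in> Sym n" "x \<in> X" for u x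
    using inversions_rprod_min_rep that by (simp add: X_def)
  note inv_d = inversions_rprod_long_cycle
  show ?thesis
  proof (intro equalityI subsetI)
    fix w assume w: "w \<in> min_det_set (n + 1) (set_prod Z X)"
    then obtain z x where z: "z \<in> Z" and x: "x \<in> X" and w_eq: "w = z \<odot> x"
      by (auto simp: min_det_set_def set_prod_def)
    obtain y where y: "y \<in> min_det_set n Z" and zy: "is_prefix n z y"
      using min_det_set_dominates[OF ZS z] by blast
    have zS: "z \<in> Sym n" and yS: "y \<in> Sym n" and yZ: "y \<in> Z"
      using zy y by (auto simp: is_prefix_iff min_det_set_def)
    have "inversions w \<subseteq> inversions (y \<odot> ?d)"
      unfolding w_eq inv[OF zS x] inv_d[OF yS] using zy by (auto simp: is_prefix_iff)
    then have "is_prefix (n + 1) w (y \<odot> ?d)"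
      using S'[OF zS x] S'[OF yS d] by (simp add: is_prefix_iff w_eq)
    moreover have "y \<odot> ?d \<in> set_prod Z X" using yZ d by (auto simp: set_prod_def)
    ultimately have "y \<odot> ?d = w" using w by (auto simp: min_det_set_def)
    then show "w \<in> (\<lambda>y. y \<odot> ?d) ` min_det_set n Z" using y by auto
  next
    fix w assume "w \<in> (\<lambda>y. y \<odot> ?d) ` min_det_set n Z"
    then obtain y where y: "y \<in> min_det_set n Z" and w_eq: "w = y \<odot> ?d" by auto
    then have yZ: "y \<in> Z" and yS: "y \<in> Sym n" using ZS by (auto simp: min_det_set_def)
    have "w \<in> set_prod Z X" using yZ d w_eq by (auto simp: set_prod_def)
    moreover have "v = w" if v: "v \<in> set_prod Z X" and wv: "is_prefix (n + 1) w v" for v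
    proof -
      obtain z x where z: "z \<in> Z" and x: "x \<in> X" and v_eq: "v = z \<odot> x"
        using v by (auto simp: set_prod_def)
      have zS: "z \<in> Sym n" using z ZS by auto
      have sub: "inversions y \<union> {1..n} \<times> {n + 1} \<subseteq> inversions v"
        using wv inv_d[OF yS] by (simp add: is_prefix_iff w_eq)
      then have "inversions y \<subseteq> inversions z"
        unfolding v_eq inv[OF zS x] using inversions_subset[OF yS] by auto
      then have "z = y" using y z yS zS by (auto simp: min_det_set_def is_prefix_iff)
      then have "inversions v = inversions w"
        using sub inv[OF zS x] unfolding v_eq w_eq inv_d[OF yS] by auto
      then show "v = w" using wv inversions_eqD by (auto simp: is_prefix_iff)
    qed
    ultimately show "w \<in> min_det_set (n + 1) (set_prod Z X)" by (auto simp: min_det_set_def)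
  qed
qed

section \<open>Diagrams and their permutations\<close>

text \<open>
  The orders in which the nodes are numbered by rows and by columns.
\<close>

definition row_le :: "nat \<times> nat \<Rightarrow> nat \<times> nat \<Rightarrow> bool"
  where "row_le u v \<longleftrightarrow> fst u < fst v \<or> (fst u = fst v \<and> snd u \<le> snd v)"

definition col_le :: "nat \<times> nat \<Rightarrow> nat \<times> nat \<Rightarrow> bool"
  where "col_le u v \<longleftrightarrow> snd u < snd v \<or> (snd u = snd v \<and> fst u \<le> fst v)"

lemma row_filling_eq: "row_filling D v = card {u \<in> D. row_le u v}"
proof -
  have "{(a', b') \<in> D. a' < fst v \<or> (a' = fst v \<and> b' \<le> snd v)} = {u \<in> D. row_le u v}"
    by (auto simp: row_le_def)
  then show ?thesis by (simp add: row_filling_def case_prod_unfold)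
qed

lemma col_filling_eq: "col_filling D v = card {u \<in> D. col_le u v}"
proof -
  have "{(a', b') \<in> D. b' < snd v \<or> (b' = snd v \<and> a' \<le> fst v)} = {u \<in> D. col_le u v}"
    by (auto simp: col_le_def)
  then show ?thesis by (simp add: col_filling_def case_prod_unfold)
qed

lemma rank_bij_betw:
  assumes fin: "finite D"
    and total: "\<And>u v. u \<in> D \<Longrightarrow> v \<in> D \<Longrightarrow> le u v \<or> le v u"
    and antisym: "\<And>u v. u \<in> D \<Longrightarrow> v \<in> D \<Longrightarrow> le u v \<Longrightarrow> le v u \<Longrightarrow> u = v"
    and trans: "\<And>u v w. u \<in> D \<Longrightarrow> v \<in> D \<Longrightarrow> w \<in> D \<Longrightarrow> le u v \<Longrightarrow> le v w \<Longrightarrow> le u w"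
  shows "bij_betw (\<lambda>v. card {u \<in> D. le u v}) D {1..card D}"
proof -
  let ?f = "\<lambda>v. card {u \<in> D. le u v}"
  have less: "?f u < ?f v" if "u \<in> D" "v \<in> D" "le u v" "u \<noteq> v" for u v
  proof (rule psubset_card_mono)
    show "finite {w \<in> D. le w v}" using fin by simp
    have "v \<in> {w \<in> D. le w v}" "v \<notin> {w \<in> D. le w u}" using total antisym that by blast+
    moreover have "{w \<in> D. le w u} \<subseteq> {w \<in> D. le w v}" using trans that by blast
    ultimately show "{w \<in> D. le w u} \<subset> {w \<in> D. le w v}" by blast
  qed
  have inj: "inj_on ?f D"
    by (rule inj_onI) (metis less total less_irrefl)
  have "?f v \<in> {1..card D}" if "v \<in> D" for v
  proof -
    have "v \<in> {u \<in> D. le u v}" using that total by blast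
    then have "?f v \<noteq> 0" using fin by auto
    moreover have "?f v \<le> card D" using fin by (intro card_mono) auto
    ultimately show ?thesis by simp
  qed
  then have "?f ` D \<subseteq> {1..card D}" by blast
  moreover have "card (?f ` D) = card {1..card D}" using card_image[OF inj] by simp
  ultimately have "?f ` D = {1..card D}" by (intro card_subset_eq) auto
  then show ?thesis using inj by (simp add: bij_betw_def)
qed

lemma row_filling_bij: "finite D \<Longrightarrow> bij_betw (row_filling D) D {1..card D}"
  unfolding row_filling_eq[abs_def]
  by (rule rank_bij_betw) (auto simp: row_le_def prod_eq_iff)

lemma col_filling_bij: "finite D \<Longrightarrow> bij_betw (col_filling D) D {1..card D}"
  unfolding col_filling_eq[abs_def]
  by (rule rank_bij_betw) (auto simp: col_le_def prod_eq_iff)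

text \<open>
  Both fillings being bijections, the defining property of \<open>w_D\<close> has exactly one solution.
\<close>

lemma diag_perm_unique:
  assumes fin: "finite D"
    and v: "v \<in> Sym (card D)" "\<And>u. u \<in> D \<Longrightarrow> v (row_filling D u) = col_filling D u"
    and w: "w \<in> Sym (card D)" "\<And>u. u \<in> D \<Longrightarrow> w (row_filling D u) = col_filling D u"
  shows "v = w"
proof
  fix i
  show "v i = w i"
  proof (cases "i \<in> {1..card D}")
    case True
    then have "i \<in> row_filling D ` D"
      using bij_betw_imp_surj_on[OF row_filling_bij[OF fin]] by simp
    then obtain u where "u \<in> D" "i = row_filling D u" by blast
    then show ?thesis using v(2) w(2) by simp
  next
    case False
    then show ?thesis using Sym_outside[OF v(1)] Sym_outside[OF w(1)] by simp
  qed
qed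

lemma diag_perm_eqI:
  assumes "finite D" "w \<in> Sym (card D)" "\<And>u. u \<in> D \<Longrightarrow> w (row_filling D u) = col_filling D u"
  shows "diag_perm D = w"
  unfolding diag_perm_def by (rule the_equality) (use assms diag_perm_unique in blast)+

lemma diag_perm_spec:
  assumes fin: "finite D"
  shows "diag_perm D \<in> Sym (card D)" "u \<in> D \<Longrightarrow> diag_perm D (row_filling D u) = col_filling D u"
proof -
  let ?g = "inv_into D (row_filling D)"
  define w where "w i = (if i \<in> {1..card D} then col_filling D (?g i) else i)" for i
  have "bij_betw (\<lambda>i. col_filling D (?g i)) {1..card D} {1..card D}"
    using bij_betw_trans[OF bij_betw_inv_into[OF row_filling_bij[OF fin]] col_filling_bij[OF fin]]
    by (simp add: comp_def)
  then have "bij_betw w {1..card D} {1..card D}"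
    by (subst bij_betw_cong[where g = "\<lambda>i. col_filling D (?g i)"]) (auto simp: w_def)
  then have wS: "w \<in> Sym (card D)"
    unfolding Sym_def by (intro CollectI bij_imp_permutes) (auto simp: w_def)
  have w: "w (row_filling D u) = col_filling D u" if "u \<in> D" for u
  proof -
    have "row_filling D u \<in> {1..card D}" using row_filling_bij[OF fin] that bij_betwE by blast
    then show ?thesis
      using that inv_into_f_f[OF bij_betw_imp_inj_on[OF row_filling_bij[OF fin]]] by (simp add: w_def)
  qed
  have "diag_perm D = w" using fin wS w by (rule diag_perm_eqI)
  then show "diag_perm D \<in> Sym (card D)" "u \<in> D \<Longrightarrow> diag_perm D (row_filling D u) = col_filling D u"
    using wS w by auto
qed

lemma diagrams_card:
  assumes "D \<in> diagrams lam"
  shows "card D = sum_list lam"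
proof -
  let ?r = "length lam" and ?B = "\<lambda>k. {b. (k, b) \<in> D}"
  have D: "finite D" "fst ` D = {1..?r}" "\<And>k. k \<in> {1..?r} \<Longrightarrow> card (?B k) = lam ! (k - 1)"
    using assms by (auto simp: diagrams_def diagram_def)
  have "D = Sigma {1..?r} ?B" using D(2) by force
  moreover have "finite (?B k)" for k
    using finite_imageI[OF D(1), of snd] by (rule finite_subset[rotated]) force
  ultimately have "card D = (\<Sum>k\<in>{1..?r}. card (?B k))" using card_SigmaI[of "{1..?r}" ?B] by simp
  also have "\<dots> = (\<Sum>k\<in>{1..?r}. lam ! (k - 1))" using D(3) by simp
  also have "\<dots> = (\<Sum>k\<in>{0..<?r}. lam ! k)"
    by (rule sum.reindex_bij_witness[of _ Suc "\<lambda>k. k - 1"]) auto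
  finally show ?thesis by (simp add: sum_list_sum_nth)
qed

lemma hat_eq: "hat r D = insert (r + 1, 1) ((\<lambda>(i, j). (i, j + 1)) ` D)"
  by (auto simp: hat_def)

text \<open>
  The new node is last by rows and first by columns. Hence numbering by rows is unchanged on the shifted
  nodes and gives \<open>n + 1\<close> at the new node, while numbering by columns goes up by one on the shifted nodes and
  gives \<open>1\<close> at the new node; that is the effect of \<open>long_cycle\<close> on the values.
\<close>

lemma hat_properties:
  assumes D: "diagram D" "fst ` D = {1..r}"
  shows "diagram (hat r D)" "card (hat r D) = card D + 1"
    "diag_perm (hat r D) = diag_perm D \<odot> long_cycle (card D)"
proof -
  let ?n = "card D" and ?H = "hat r D" and ?new = "(r + 1, 1::nat)"
  define sh :: "nat \<times> nat \<Rightarrow> nat \<times> nat" where "sh = (\<lambda>(i, j). (i, j + 1))"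
  have H: "?H = insert ?new (sh ` D)" by (simp add: hat_eq sh_def)
  obtain c where fin: "finite D" and c: "snd ` D = {1..c}" using D by (auto simp: diagram_def)
  have inj: "inj sh" by (auto simp: inj_def sh_def)
  have bounds: "fst u \<le> r" "1 \<le> snd u" if "u \<in> D" for u
    using that D(2) c by (metis atLeastAtMost_iff imageI)+
  have new: "?new \<notin> sh ` D" using bounds(1) by (force simp: sh_def)
  have finH: "finite ?H" using fin H by simp
  show card: "card ?H = ?n + 1"
    using new fin card_image[OF inj_on_subset[OF inj], of D] by (simp add: H)
  have "fst ` ?H = {1..r + 1}"
  proof -
    have "fst ` sh ` D = fst ` D" by (auto simp: sh_def image_image case_prod_unfold)
    then show ?thesis using D(2) by (auto simp: H)
  qed
  moreover have "snd ` ?H = {1..c + 1}"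
  proof -
    have "snd ` sh ` D = Suc ` snd ` D" by (auto simp: sh_def image_image case_prod_unfold)
    then have "snd ` ?H = insert 1 {2..Suc c}" using c by (simp add: H numeral_2_eq_2)
    then show ?thesis by auto
  qed
  ultimately show "diagram ?H" using finH H unfolding diagram_def by blast
  have sh_le: "row_le (sh u) (sh v) = row_le u v" "col_le (sh u) (sh v) = col_le u v" for u v
    by (auto simp: sh_def row_le_def col_le_def case_prod_unfold)
  have row_sh: "row_filling ?H (sh u) = row_filling D u" if u: "u \<in> D" for u
  proof -
    have "\<not> row_le ?new (sh u)" using bounds[OF u] by (auto simp: row_le_def sh_def case_prod_unfold)
    then have "{v \<in> ?H. row_le v (sh u)} = sh ` {v \<in> D. row_le v u}"
      unfolding H using sh_le by blast
    then show ?thesis unfolding row_filling_eq using card_image[OF inj_on_subset[OF inj]] by simp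
  qed
  have col_sh: "col_filling ?H (sh u) = Suc (col_filling D u)" if u: "u \<in> D" for u
  proof -
    have "col_le ?new (sh u)" using bounds[OF u] by (auto simp: col_le_def sh_def case_prod_unfold)
    then have "{v \<in> ?H. col_le v (sh u)} = insert ?new (sh ` {v \<in> D. col_le v u})"
      unfolding H using sh_le by blast
    moreover have "?new \<notin> sh ` {v \<in> D. col_le v u}" using new by auto
    ultimately show ?thesis unfolding col_filling_eq
      using card_image[OF inj_on_subset[OF inj], of "{v \<in> D. col_le v u}"] fin by simp
  qed
  have "{v \<in> ?H. row_le v ?new} = ?H"
    unfolding H using bounds(1) by (force simp: row_le_def sh_def)
  then have row_new: "row_filling ?H ?new = ?n + 1" using card unfolding row_filling_eq by simp
  have "{v \<in> ?H. col_le v ?new} = {?new}"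
    unfolding H using bounds(2) by (force simp: col_le_def sh_def)
  then have col_new: "col_filling ?H ?new = 1" unfolding col_filling_eq by simp
  show "diag_perm ?H = diag_perm D \<odot> long_cycle ?n"
  proof (rule diag_perm_eqI[OF finH])
    have "long_cycle ?n \<in> Sym (?n + 1)" using long_cycle_min_rep by (simp add: min_reps_def)
    then show "diag_perm D \<odot> long_cycle ?n \<in> Sym (card ?H)"
      using diag_perm_spec(1)[OF fin] Sym_mono[of ?n "?n + 1"] unfolding card
      by (intro Sym_rprod) auto
    fix u assume "u \<in> ?H"
    then consider "u = ?new" | v where "v \<in> D" "u = sh v" using H by auto
    then show "(diag_perm D \<odot> long_cycle ?n) (row_filling ?H u) = col_filling ?H u"
    proof cases
      case 1
      have "diag_perm D (?n + 1) = ?n + 1" using Sym_outside[OF diag_perm_spec(1)[OF fin]] by simp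
      then show ?thesis using 1 row_new col_new by (simp add: rprod_apply long_cycle_def)
    next
      case 2
      have "col_filling D v \<in> {1..?n}" using col_filling_bij[OF fin] 2(1) bij_betwE by blast
      then show ?thesis using 2 row_sh col_sh diag_perm_spec(2)[OF fin 2(1)]
        by (simp add: rprod_apply long_cycle_def)
    qed
  qed
qed

text \<open>
  Place the node numbered \<open>i\<close> by rows in column \<open>y i\<close>, so that every column has one node. Rows are then
  filled from left to right precisely because \<open>y\<close> is increasing on each block of \<open>J(\<lambda>)\<close>. So some
  diagram for \<open>y\<close> exists, and with it one with the fewest columns, \<open>D(y, \<lambda>)\<close>.
\<close>

lemma diagram_of_min_rep:
  assumes n: "n \<ge> 1" and lam: "composition n lam" and y: "y \<in> min_reps n (J_comp lam)"
  obtains E where "E \<in> diagrams lam" "diag_perm E = y"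
proof -
  let ?r = "length lam"
  \<comment> \<open>Row \<open>a\<close> consists of the numbers above \<open>S (a - 1)\<close> and up to \<open>S a\<close>.\<close>
  define S where "S k = sum_list (take k lam)" for k
  define row where "row i = (LEAST a. i \<le> S a)" for i
  define f where "f i = (row i, y i)" for i
  define E where "E = f ` {1..n}"
  have sum: "sum_list lam = n" and pos: "0 \<notin> set lam" using lam by (auto simp: composition_def)
  have S0: "S 0 = 0" and Sr: "S ?r = n" by (simp_all add: S_def sum)
  have SSuc: "S (Suc k) = S k + lam ! k" if "k < ?r" for k
    using that by (simp add: S_def take_Suc_conv_app_nth)
  have S_mono: "S k \<le> S l" if "k \<le> l" for k l
  proof -
    have "take l lam = take k lam @ take (l - k) (drop k lam)"
      using that by (metis le_add_diff_inverse take_add)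
    then show ?thesis by (simp add: S_def)
  qed
  have S_le: "S k \<le> n" for k
    using S_mono[of k "max k ?r"] sum by (simp add: S_def max_def split: if_splits)
  have row1: "i \<le> S (row i)" and row2: "a < row i \<Longrightarrow> S a < i" and row3: "row i \<le> ?r"
    if "i \<in> {1..n}" for i a
  proof -
    have "i \<le> S ?r" using that Sr by simp
    then show "i \<le> S (row i)" "row i \<le> ?r" unfolding row_def by (auto intro: LeastI Least_le)
    show "S a < i" if "a < row i" using not_less_Least that unfolding row_def by (metis not_less)
  qed
  have row_pos: "1 \<le> row i" if "i \<in> {1..n}" for i
    using row1[OF that] S0 that by (cases "row i") auto
  have row_mono: "row i \<le> row j" if "i \<le> j" "j \<in> {1..n}" for i j
    using row1[OF that(2)] that(1) unfolding row_def by (intro Least_le) simp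
  have row_iff: "{i \<in> {1..n}. row i = k} = {S (k - 1)<..S k}" if k: "k \<in> {1..?r}" for k
  proof (intro equalityI subsetI)
    fix i assume "i \<in> {i \<in> {1..n}. row i = k}"
    then show "i \<in> {S (k - 1)<..S k}" using row1[of i] row2[of i "k - 1"] k by auto
  next
    fix i assume i: "i \<in> {S (k - 1)<..S k}"
    then have i': "i \<in> {1..n}" using S_le[of k] by auto
    have "row i \<le> k" using i unfolding row_def by (intro Least_le) simp
    moreover have "\<not> row i \<le> k - 1" using S_mono[of "row i" "k - 1"] row1[OF i'] i by auto
    ultimately show "i \<in> {i \<in> {1..n}. row i = k}" using i' by simp
  qed
  have J: "J_comp lam \<subseteq> {1..<n}" by (auto simp: J_comp_def sum)
  have yS: "y \<in> Sym n" and inc: "\<And>k. k \<in> J_comp lam \<Longrightarrow> y k < y (Suc k)"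
    using y by (auto simp: min_reps_iff[OF J])
  have y_less: "y i < y j" if ij: "i < j" "i \<in> {1..n}" "j \<in> {1..n}" "row i = row j" for i j
  proof -
    have "k \<in> J_comp lam" if k: "k \<in> {i..<j}" for k
    proof -
      have "k \<noteq> S m" for m
      proof (cases "m < row i")
        case True
        then show ?thesis using row2[OF ij(2) True] k by auto
      next
        case False
        then show ?thesis using S_mono[of "row j" m] row1[OF ij(3)] k ij(4) by auto
      qed
      then show ?thesis using k ij by (auto simp: J_comp_def sum S_def)
    qed
    then show ?thesis using increasing_interval[of i j y] inc \<open>i < j\<close> by blast
  qed
  have y_img: "y ` {1..n} = {1..n}" using yS by (auto simp: Sym_def permutes_image)
  have inj: "inj f" using Sym_inj[OF yS] by (auto simp: f_def inj_def)
  have card_f: "card (f ` A) = card A" for A using card_image[OF inj_on_subset[OF inj]] by auto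
  have fin: "finite E" by (simp add: E_def)
  have cardE: "card E = n" by (simp add: E_def card_f)
  have row_le_iff: "row_le (f i) (f j) \<longleftrightarrow> i \<le> j" if ij: "i \<in> {1..n}" "j \<in> {1..n}" for i j
  proof -
    have "row_le (f i) (f j)" if "i \<le> j" "i \<in> {1..n}" "j \<in> {1..n}" for i j
      using row_mono[OF that(1,3)] y_less[of i j] that by (cases "i = j") (auto simp: row_le_def f_def)
    moreover have "\<not> row_le (f i) (f j)" if "j < i"
      using row_mono[of j i] y_less[of j i] that ij by (auto simp: row_le_def f_def)
    ultimately show ?thesis using ij by (metis not_le)
  qed
  have row_fill: "row_filling E (f i) = i" if i: "i \<in> {1..n}" for i
  proof -
    have "{u \<in> E. row_le u (f i)} = f ` {1..i}"
      using row_le_iff i unfolding E_def by (auto simp: image_iff)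
    then show ?thesis by (simp add: row_filling_eq card_f)
  qed
  have col_fill: "col_filling E (f i) = y i" if i: "i \<in> {1..n}" for i
  proof -
    have "col_le (f j) (f i) \<longleftrightarrow> y j \<le> y i" for j
      using Sym_eq_iff[OF yS, of j i] by (auto simp: col_le_def f_def)
    then have "{u \<in> E. col_le u (f i)} = f ` {j \<in> {1..n}. y j \<le> y i}"
      unfolding E_def by auto
    moreover have "y ` {j \<in> {1..n}. y j \<le> y i} = {1..y i}"
    proof -
      have yi: "y i \<le> n" using Sym_range[OF yS, of i] i by auto
      show ?thesis
      proof (intro equalityI subsetI)
        fix m assume "m \<in> y ` {j \<in> {1..n}. y j \<le> y i}"
        then obtain j where "j \<in> {1..n}" "m = y j" "y j \<le> y i" by blast
        then show "m \<in> {1..y i}" using Sym_range[OF yS, of j] by simp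
      next
        fix m assume m: "m \<in> {1..y i}"
        then have "m \<in> y ` {1..n}" using yi y_img by simp
        then obtain j where "j \<in> {1..n}" "m = y j" by blast
        then show "m \<in> y ` {j \<in> {1..n}. y j \<le> y i}" using m by simp
      qed
    qed
    then have "card {j \<in> {1..n}. y j \<le> y i} = y i"
      using card_image[OF inj_on_subset[OF Sym_inj[OF yS]], of "{j \<in> {1..n}. y j \<le> y i}"] by simp
    ultimately show ?thesis by (simp add: col_filling_eq card_f)
  qed
  have "diag_perm E = y"
    by (rule diag_perm_eqI[OF fin]) (use yS cardE row_fill col_fill in \<open>auto simp: E_def\<close>)
  moreover have "E \<in> diagrams lam"
  proof -
    have "fst ` E = row ` {1..n}" by (simp add: E_def f_def image_image)
    also have "\<dots> = {1..?r}"
    proof (intro equalityI subsetI)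
      fix a assume "a \<in> row ` {1..n}"
      then show "a \<in> {1..?r}" using row3 row_pos by auto
    next
      fix a assume a: "a \<in> {1..?r}"
      have "a - 1 < ?r" using a by auto
      then have "lam ! (a - 1) \<in> set lam" by (rule nth_mem)
      then have "lam ! (a - 1) \<noteq> 0" using pos by metis
      then have "S (a - 1) < S a" using SSuc[OF \<open>a - 1 < ?r\<close>] a by simp
      then have "S a \<in> {i \<in> {1..n}. row i = a}" unfolding row_iff[OF a] by simp
      then show "a \<in> row ` {1..n}" by (intro image_eqI[of _ _ "S a"]) simp_all
    qed
    finally have rows: "fst ` E = {1..?r}" .
    have "snd ` E = y ` {1..n}" by (simp add: E_def f_def image_image)
    then have cols: "snd ` E = {1..n}" using y_img by simp
    have "card {b. (k, b) \<in> E} = lam ! (k - 1)" if k: "k \<in> {1..?r}" for k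
    proof -
      have "{b. (k, b) \<in> E} = y ` {i \<in> {1..n}. row i = k}" by (auto simp: E_def f_def)
      then have "card {b. (k, b) \<in> E} = card {S (k - 1)<..S k}"
        unfolding row_iff[OF k] using card_image[OF inj_on_subset[OF Sym_inj[OF yS]]] by simp
      moreover have "k - 1 < ?r" using k by auto
      ultimately show ?thesis using SSuc[of "k - 1"] k by simp
    qed
    moreover have "E \<noteq> {}" using n by (auto simp: E_def)
    ultimately show ?thesis using rows cols fin unfolding diagrams_def diagram_def by blast
  qed
  ultimately show ?thesis using that by blast
qed

lemma D_of_spec:
  assumes "n \<ge> 1" "composition n lam" "y \<in> min_reps n (J_comp lam)"
  shows "D_of y lam \<in> diagrams lam" "diag_perm (D_of y lam) = y"
proof -
  obtain E where "E \<in> diagrams lam" "diag_perm E = y" using diagram_of_min_rep[OF assms] .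
  then have "D_of y lam \<in> diagrams lam \<and> diag_perm (D_of y lam) = y"
    unfolding D_of_def by (intro arg_min_natI) simp
  then show "D_of y lam \<in> diagrams lam" "diag_perm (D_of y lam) = y" by auto
qed

theorem mainTheorem3:
  fixes n r :: nat and lam :: "nat list"
  assumes "n \<ge> 1" and "composition n lam" and "length lam = r"
  defines "X \<equiv> min_reps (n + 1) {1..<n}"
  shows "(\<forall>D\<in>E_set lam. diagram (hat r D) \<and> card (hat r D) = n + 1) \<and>
    right_ideal (n + 1) (set_prod (Z_set lam) X) \<and>
    min_det_set (n + 1) (set_prod (Z_set lam) X) = {diag_perm (hat r D) | D. D \<in> E_set lam}"
proof -
  have sum: "sum_list lam = n" using assms(2) by (simp add: composition_def)
  have Z: "right_ideal n (Z_set lam)" using Z_set_right_ideal sum by metis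
  then have ZS: "Z_set lam \<subseteq> Sym n" by (simp add: right_ideal_def)
  have hat: "diagram (hat r (D_of y lam))" "card (hat r (D_of y lam)) = n + 1"
    "diag_perm (hat r (D_of y lam)) = y \<odot> long_cycle n" if "y \<in> Y_set lam" for y
  proof -
    have "y \<in> min_reps n (J_comp lam)"
      using that by (simp add: Y_set_def min_det_set_def Z_set_def Let_def sum)
    note D = D_of_spec[OF assms(1,2) this]
    have "diagram (D_of y lam)" "fst ` D_of y lam = {1..r}"
      using D(1) assms(3) by (auto simp: diagrams_def)
    note hat_properties[OF this]
    then show "diagram (hat r (D_of y lam))" "card (hat r (D_of y lam)) = n + 1"
      "diag_perm (hat r (D_of y lam)) = y \<odot> long_cycle n"
      using D diagrams_card[OF D(1)] sum by simp_all
  qed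
  have "min_det_set (n + 1) (set_prod (Z_set lam) X) = (\<lambda>y. y \<odot> long_cycle n) ` Y_set lam"
    using min_det_set_induced[OF ZS] by (simp add: X_def Y_set_def sum)
  also have "\<dots> = {diag_perm (hat r D) | D. D \<in> E_set lam}"
    using hat(3) by (force simp: E_set_def)
  finally have "min_det_set (n + 1) (set_prod (Z_set lam) X) = {diag_perm (hat r D) | D. D \<in> E_set lam}" .
  moreover have "\<forall>D\<in>E_set lam. diagram (hat r D) \<and> card (hat r D) = n + 1"
    using hat by (auto simp: E_set_def)
  ultimately show ?thesis using right_ideal_induced[OF Z] by (simp add: X_def)
qed

end
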